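(* Let $a_0,a_1$ be two masks (finitely supported sequences on $\mathbb{Z}^2$). The adaptive directional subdivision scheme based on the masks $a_\varepsilon$, $\varepsilon\in\{0,1\}$, converges if and only if $a_\varepsilon^*(z)\in I$ for $\varepsilon\in\{0,1\}$ and the representation masks $B_\varepsilon$, $\varepsilon\in\{0,1\}$, satisfy $\rho(B_0,B_1\,|\,\nabla)<1$.
   Context: Let $W_0=\begin{pmatrix}4&0\\ 0&2\end{pmatrix}$, $W_1=\begin{pmatrix}4&-4\\ 0&2\end{pmatrix}$, and $W_\varepsilon=W_{\varepsilon_n}\cdots W_{\varepsilon_1}$ for $\varepsilon=(\varepsilon_1,\dots,\varepsilon_n)\in\{0,1\}^n$. For $\eta\in\{0,1\}$ let $(S_\eta c)(\alpha)=\sum_{\beta\in\mathbb{Z}^2}a_\eta(\alpha-W_\eta\beta)c(\beta)$, $c\in\ell_\infty(\mathbb{Z}^2)$, and $S_\varepsilon=S_{\varepsilon_n}\cdots S_{\varepsilon_1}$ for $\varepsilon\in\{0,1\}^n$. Let $E_\infty=\{0,1\}^{\mathbb{N}}$ with $\mathbb N=\{1,2,\dots\}$, $P_n\varepsilon=(\varepsilon_1,\dots,\varepsilon_n)$ for $\varepsilon\in E_\infty$, and $\delta(\alpha)=1$ if $\alpha=0$ and $0$ otherwise. Convergence: the adaptive directional subdivision scheme based on $a_0,a_1$ is convergent (in $C(\mathbb{R}^2)$) if for every $\varepsilon\in E_\infty$ there is a nonzero uniformly continuous function $f_\varepsilon\in C(\mathbb{R}^2)$ with $\lim_{n\to\infty}\sup_{\alpha\in\mathbb{Z}^2}|f_\varepsilon(W_{P_n\varepsilon}^{-1}\alpha)-S_{P_n\varepsilon}\delta(\alpha)|=0$.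 Algebra: $\Lambda$ is the ring of Laurent polynomials in $z=(z_1,z_2)$; the symbol of a finitely supported (scalar or matrix) sequence $a$ is $a^*(z)=\sum_\alpha a(\alpha)z^\alpha$. For $X=[x_1,x_2]\in\mathbb{Z}^{2\times2}$ with columns $x_1,x_2$ write $\langle z^X-1\rangle=\langle z^{x_1}-1,z^{x_2}-1\rangle$ (ideal in $\Lambda$), $[z^X-1]=\begin{pmatrix} z^{x_1}-1 \\ z^{x_2}-1 \end{pmatrix}$ and $[z-1]=\begin{pmatrix} z_1-1 \\ z_2-1 \end{pmatrix}$. The ideal $I\subset\Lambda$ is the quotient ideal $I=\langle z^{W_0}-1\rangle:\langle z_1-1,z_2-1\rangle=\{f\in\Lambda: f(z)(z_j-1)\in\langle z_1^4-1,z_2^2-1\rangle,\ j=1,2\}$; it coincides with $\langle z^{W_1}-1\rangle:\langle z_1-1,z_2-1\rangle$. Representation masks: if $a_\varepsilon^*\in I$, a representation mask of $a_\varepsilon$ ($\varepsilon\in\{0,1\}$) is a finitely supported sequence $B_\varepsilon$ of $2\times2$ matrices on $\mathbb{Z}^2$ with $[z-1]\,a_\varepsilon^*(z)=B_\varepsilon^*(z)\,[z^{W_\varepsilon}-1]$. It exists but is not unique; $B_0,B_1$ denote a fixed choice. Restricted joint spectral radius: $\nabla c=\begin{pmatrix} c(\cdot-(1,0))-c \\ c(\cdot-(0,1))-c \end{pmatrix}$; for $\eta\in\{0,1\}$, $(S^B_\eta v)(\alpha)=\sum_\beta B_\eta(\alpha-W_\eta\beta)v(\beta)$ for bounded $2$-vector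 valued sequences $v$ on $\mathbb{Z}^2$, $S^B_\varepsilon=S^B_{\varepsilon_n}\cdots S^B_{\varepsilon_1}$ for $\varepsilon\in\{0,1\}^n$, and $$\rho(B_0,B_1\,|\,\nabla)=\limsup_{n\to\infty}\ \sup_{\varepsilon\in\{0,1\}^n}\ \sup_{v\in\nabla\ell_\infty(\mathbb{Z}^2),\ \|v\|_\infty\le1}\|S^B_\varepsilon v\|_\infty^{1/n},$$ with $\|v\|_\infty$ the supremum over $\mathbb{Z}^2$ of the maximum norm of the vectors.
   Formalization: The right-hand side also requires that the coefficients of each mask sum to 8, i.e. a_ε^*(1) = |det W_ε| = 8; without this the claim fails for a_0 = a_1 = 0 with B_0 = B_1 = 0, where ρ = 0 but the scheme does not converge. *)

theory Defs
  imports "HOL-Analysis.Analysis" "HOL-Library.Poly_Mapping" "HOL-Library.Z2"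
begin

section \<open>Adaptive directional subdivision\<close>

text \<open>
  The index set {0,1} is the type \<^typ>\<open>bit\<close>, and Z^2 is \<^typ>\<open>int^2\<close>. A finite word
  (e_1, ..., e_n) is the list [e_1, ..., e_n]; \<^const>\<open>fold\<close> applies the operator of e_1 first,
  so it yields the products X_{e_n} ... X_{e_1}.
\<close>

definition W :: "bit \<Rightarrow> int^2^2" where
  "W \<eta> = (if \<eta> = 0 then vector [vector [4, 0], vector [0, 2]]
                    else vector [vector [4, -4], vector [0, 2]])"

definition W_word :: "bit list \<Rightarrow> int^2^2" where
  "W_word \<epsilon> = fold (\<lambda>\<eta> M. W \<eta> ** M) \<epsilon> (mat 1)"

text \<open>
  Elements of {0,1}^N, N = {1,2,...}, are functions \<^typ>\<open>nat \<Rightarrow> bit\<close> whose value at 0 is never used.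
\<close>

definition P :: "nat \<Rightarrow> (nat \<Rightarrow> bit) \<Rightarrow> bit list" where
  "P n \<epsilon> = map \<epsilon> [1..<Suc n]"

text \<open>
  For a mask a (finitely supported) the index set of the sum is finite, since W is injective.
\<close>

definition subdiv :: "(bit \<Rightarrow> int^2 \<Rightarrow> real) \<Rightarrow> bit \<Rightarrow> (int^2 \<Rightarrow> real) \<Rightarrow> int^2 \<Rightarrow> real" where
  "subdiv a \<eta> c \<alpha> = (\<Sum>\<beta> | a \<eta> (\<alpha> - W \<eta> *v \<beta>) \<noteq> 0. a \<eta> (\<alpha> - W \<eta> *v \<beta>) * c \<beta>)"

definition subdiv_word :: "(bit \<Rightarrow> int^2 \<Rightarrow> real) \<Rightarrow> bit list \<Rightarrow> (int^2 \<Rightarrow> real) \<Rightarrow> int^2 \<Rightarrow> real" where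
  "subdiv_word a \<epsilon> = fold (subdiv a) \<epsilon>"

definition delta :: "int^2 \<Rightarrow> real" where
  "delta \<alpha> = (if \<alpha> = 0 then 1 else 0)"

definition scheme_convergent :: "(bit \<Rightarrow> int^2 \<Rightarrow> real) \<Rightarrow> bool" where
  "scheme_convergent a \<longleftrightarrow>
     (\<forall>\<epsilon> :: nat \<Rightarrow> bit. \<exists>f :: real^2 \<Rightarrow> real. uniformly_continuous_on UNIV f \<and> (\<exists>x. f x \<noteq> 0) \<and>
        (\<lambda>n. SUP \<alpha>. ereal \<bar>f (matrix_inv (map_matrix real_of_int (W_word (P n \<epsilon>))) *v (\<chi> i. real_of_int (\<alpha> $ i)))
                          - subdiv_word a (P n \<epsilon>) delta \<alpha>\<bar>) \<longlonglongrightarrow> 0)"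

section \<open>Laurent polynomials and representation masks\<close>

text \<open>
  Laurent polynomials in two variables form the group ring of Z^2: multiplication on
  \<^type>\<open>poly_mapping\<close> is convolution, with z^x z^y = z^(x+y).
\<close>

type_synonym laurent = "(int^2) \<Rightarrow>\<^sub>0 real"

definition zpow :: "int^2 \<Rightarrow> laurent" where
  "zpow x = Poly_Mapping.single x 1"

definition zvar :: "2 \<Rightarrow> laurent" where
  "zvar j = zpow (axis j 1)"

definition symbol :: "(int^2 \<Rightarrow> real) \<Rightarrow> laurent" where
  "symbol a = (\<Sum>\<alpha> | a \<alpha> \<noteq> 0. Poly_Mapping.single \<alpha> (a \<alpha>))"

definition matrix_symbol :: "(int^2 \<Rightarrow> real^2^2) \<Rightarrow> laurent^2^2" where
  "matrix_symbol B = (\<chi> i j. symbol (\<lambda>\<alpha>. B \<alpha> $ i $ j))"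

definition ideal2 :: "laurent \<Rightarrow> laurent \<Rightarrow> laurent set" where
  "ideal2 f g = {p * f + q * g | p q. True}"

definition ideal_quotient :: "laurent set \<Rightarrow> laurent set \<Rightarrow> laurent set" where
  "ideal_quotient A B = {f. \<forall>g\<in>B. f * g \<in> A}"

definition I :: "laurent set" where
  "I = ideal_quotient (ideal2 (zpow (column 1 (W 0)) - 1) (zpow (column 2 (W 0)) - 1))
                      (ideal2 (zvar 1 - 1) (zvar 2 - 1))"

definition representation_mask :: "bit \<Rightarrow> (int^2 \<Rightarrow> real) \<Rightarrow> (int^2 \<Rightarrow> real^2^2) \<Rightarrow> bool" where
  "representation_mask \<eta> a B \<longleftrightarrow>
     finite {\<alpha>. B \<alpha> \<noteq> 0} \<and>
     (\<chi> j. (zvar j - 1) * symbol a) = matrix_symbol B *v (\<chi> j. zpow (column j (W \<eta>)) - 1)"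

section \<open>Restricted joint spectral radius\<close>

definition nabla :: "(int^2 \<Rightarrow> real) \<Rightarrow> int^2 \<Rightarrow> real^2" where
  "nabla c \<alpha> = (\<chi> j. c (\<alpha> - axis j 1) - c \<alpha>)"

definition vsubdiv :: "(bit \<Rightarrow> int^2 \<Rightarrow> real^2^2) \<Rightarrow> bit \<Rightarrow> (int^2 \<Rightarrow> real^2) \<Rightarrow> int^2 \<Rightarrow> real^2" where
  "vsubdiv B \<eta> v \<alpha> = (\<Sum>\<beta> | B \<eta> (\<alpha> - W \<eta> *v \<beta>) \<noteq> 0. B \<eta> (\<alpha> - W \<eta> *v \<beta>) *v v \<beta>)"

definition vsubdiv_word ::
    "(bit \<Rightarrow> int^2 \<Rightarrow> real^2^2) \<Rightarrow> bit list \<Rightarrow> (int^2 \<Rightarrow> real^2) \<Rightarrow> int^2 \<Rightarrow> real^2" where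
  "vsubdiv_word B \<epsilon> = fold (vsubdiv B) \<epsilon>"

text \<open>
  \<^const>\<open>infnorm\<close> is the maximum norm. The real supremum is meaningful because
  supnorm is only applied to bounded sequences.
\<close>

definition supnorm :: "(int^2 \<Rightarrow> real^2) \<Rightarrow> real" where
  "supnorm v = (SUP \<alpha>. infnorm (v \<alpha>))"

definition restricted_jsr :: "(bit \<Rightarrow> int^2 \<Rightarrow> real^2^2) \<Rightarrow> ereal" where
  "restricted_jsr B =
     limsup (\<lambda>n. SUP \<epsilon> \<in> {\<epsilon>. length \<epsilon> = n}. SUP v \<in> {nabla c | c. bounded (range c) \<and> supnorm (nabla c) \<le> 1}.
       ereal (root n (supnorm (vsubdiv_word B \<epsilon> v))))"

end

theory Submission
  imports Defs
begin

text \<open>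
  Write \<open>S\<^sub>w\<close> for \<open>subdiv_word a w\<close>. Since \<open>W\<^sub>\<eta>\<close> has determinant 8, the sum of \<open>a\<^sub>\<eta>\<close> splits into 8
  sums over cosets of a sublattice of \<open>\<int>\<^sup>2\<close>, and \<open>\<langle>z\<^sup>W - 1\<rangle>\<close> is the set of Laurent polynomials all of
  whose coset sums vanish (\<open>lattice_ideal_iff\<close>). Hence \<open>a\<^sub>\<eta>\<^sup>* \<in> I\<close> says that the coset sums are equal,
  and together with total mass 8 it says that \<open>S\<^sub>\<eta>\<close> reproduces constants (\<open>reproduces_const_iff\<close>).
  The representation masks are made so that \<open>\<nabla> S\<^sub>w c = S\<^sup>B\<^sub>w \<nabla> c\<close>; thus the restricted joint spectral
  radius is below 1 iff the steps (differences of neighbouring values) of \<open>S\<^sub>w c\<close> decay geometrically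
  in the length of \<open>w\<close>, uniformly over all words and all bounded \<open>c\<close> with steps at most 1.

  If the steps decay, sampling \<open>S\<^sub>w \<delta>\<close> at the lattice point \<open>\<lfloor>W\<^sub>w x\<rfloor>\<close> gives piecewise constant functions
  whose successive differences are bounded by steps, because \<open>S\<^sub>\<eta>\<close> forms affine combinations of nearby
  values. They converge uniformly, the limit is uniformly continuous because the jumps tend to 0, and it
  is not zero because boundedly many translates of \<open>S\<^sub>w \<delta>\<close> add up to 1 (\<open>decay_imp_convergent\<close>).

  Conversely, suppose that the scheme converges. Along the constant sequence \<open>\<eta>, \<eta>, \<dots>\<close>, consider a
  point \<open>x\<close> where the limit is not zero: one more subdivision step multiplies the nearly constant data
  around \<open>x\<close> by a coset sum, which must therefore be 1 (\<open>convergent_imp_reproduces_const\<close>).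
  Uniform continuity of the limit makes the steps of \<open>S\<^sub>w \<delta>\<close> tend to 0 along every infinite sequence, but
  at a speed that may depend on the sequence. Two facts make the decay uniform. The value
  \<open>S\<^sub>w c \<alpha>\<close> depends only on boundedly many values of \<open>c\<close>, with a bound independent of \<open>w\<close>
  (\<open>subdiv_word_local\<close>), and constants are reproduced, so the steps of \<open>S\<^sub>w c\<close> are at most a constant times
  the steps of \<open>S\<^sub>w \<delta>\<close> times the steps of \<open>c\<close> (\<open>step_bound_subdiv_word\<close>). Hence every infinite sequence
  has a prefix that halves the steps of all sequences, and by compactness of the space of infinite
  sequences the lengths of these prefixes can be bounded (\<open>uniform_prefix_bound\<close>); cutting a long word into
  such prefixes gives geometric decay.
\<close>

section \<open>Geometry of the dilation matrices\<close>

definition emb :: "int^2 \<Rightarrow> real^2" where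
  "emb \<alpha> = (\<chi> i. real_of_int (\<alpha> $ i))"

text \<open>The action of \<open>W\<^sub>\<eta>\<^sup>-\<^sup>1\<close> on the plane (\<open>map_W_contract\<close>).\<close>

definition contract :: "bit \<Rightarrow> real^2 \<Rightarrow> real^2" where
  "contract \<eta> x = vector [x $ 1 / 4 + (if \<eta> = 0 then 0 else x $ 2 / 2), x $ 2 / 2]"

text \<open>
  The matrix product \<open>W\<^sub>w\<close> applies the first letter of \<open>w\<close> first, so its inverse applies the first
  letter last, which is the order of \<^const>\<open>foldr\<close>.
\<close>

definition contract_word :: "bit list \<Rightarrow> real^2 \<Rightarrow> real^2" where
  "contract_word = foldr contract"

lemma contract_word_simps [simp]:
  "contract_word [] x = x"
  "contract_word (\<eta> # w) x = contract \<eta> (contract_word w x)"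
  by (simp_all add: contract_word_def)

lemma contract_word_append: "contract_word (u @ w) x = contract_word u (contract_word w x)"
  by (simp add: contract_word_def)

lemma emb_nth [simp]: "emb \<alpha> $ i = real_of_int (\<alpha> $ i)"
  by (simp add: emb_def)

lemma emb_arith:
  "emb (\<alpha> + \<beta>) = emb \<alpha> + emb \<beta>" "emb (\<alpha> - \<beta>) = emb \<alpha> - emb \<beta>"
  by (simp_all add: vec_eq_iff)

lemma W_mult_nth [simp]:
  "(W \<eta> *v \<beta>) $ 1 = 4 * \<beta> $ 1 - (if \<eta> = 0 then 0 else 4 * \<beta> $ 2)"
  "(W \<eta> *v \<beta>) $ 2 = 2 * \<beta> $ 2"
  by (simp_all add: W_def matrix_vector_mult_def sum_2)

lemma inj_W: "W \<eta> *v \<beta> = W \<eta> *v \<gamma> \<longleftrightarrow> \<beta> = \<gamma>"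
  by (auto simp: vec_eq_iff forall_2)

lemma contract_nth [simp]:
  "contract \<eta> x $ 1 = x $ 1 / 4 + (if \<eta> = 0 then 0 else x $ 2 / 2)"
  "contract \<eta> x $ 2 = x $ 2 / 2"
  by (simp_all add: contract_def)

lemma contract_W: "contract \<eta> (emb (W \<eta> *v \<beta>)) = emb \<beta>"
  by (simp add: vec_eq_iff forall_2 field_simps)

lemma linear_contract: "linear (contract \<eta>)"
  by (rule linearI) (auto simp: vec_eq_iff forall_2 field_simps)

lemma linear_contract_word: "linear (contract_word w)"
proof (induction w)
  case (Cons \<eta> w)
  have "contract_word (\<eta> # w) = contract \<eta> \<circ> contract_word w"
    by (rule ext) simp
  then show ?case
    using linear_compose[OF Cons linear_contract] by metis
qed (simp add: linear_iff)

text \<open>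
  The maximum norm is chosen because both inverses contract it at a common rate (the absolute row sums
  of \<open>W\<^sub>\<eta>\<^sup>-\<^sup>1\<close> are at most 3/4), so that arbitrary products contract as well.
\<close>

lemma infnorm_contract: "infnorm (contract \<eta> x) \<le> 3 / 4 * infnorm x"
proof -
  have "\<bar>x $ 1 / 4 + x $ 2 / 2\<bar> \<le> \<bar>x $ 1\<bar> / 4 + \<bar>x $ 2\<bar> / 2"
    by linarith
  then show ?thesis
    by (auto simp: infnorm_2 max_def)
qed

lemma infnorm_contract_word: "infnorm (contract_word w x) \<le> (3 / 4) ^ length w * infnorm x"
proof (induction w)
  case (Cons \<eta> w)
  have "infnorm (contract_word (\<eta> # w) x) \<le> 3 / 4 * infnorm (contract_word w x)"
    using infnorm_contract by simp
  also have "\<dots> \<le> 3 / 4 * ((3 / 4) ^ length w * infnorm x)"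
    using Cons by simp
  finally show ?case by simp
qed simp

lemma infnorm_contract_word_le: "infnorm (contract_word w x) \<le> infnorm x"
  by (rule order_trans[OF infnorm_contract_word])
     (simp add: infnorm_pos_le mult_left_le_one_le power_le_one)

lemma W_word_simps:
  "W_word [] = mat 1"
  "W_word (\<eta> # w) = W_word w ** W \<eta>"
proof -
  have "fold (\<lambda>\<eta> M. W \<eta> ** M) w (N ** M) = fold (\<lambda>\<eta> M. W \<eta> ** M) w N ** M" for M N
    by (induction w arbitrary: N) (simp_all add: matrix_mul_assoc)
  from this[of "mat 1" "W \<eta>"] show "W_word (\<eta> # w) = W_word w ** W \<eta>"
    by (simp add: W_word_def)
qed (simp add: W_word_def)

lemma W_word_Cons_mult: "W_word (\<eta> # w) *v \<beta> = W_word w *v (W \<eta> *v \<beta>)"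
  by (simp add: W_word_simps matrix_vector_mul_assoc)

lemma map_matrix_mult:
  "map_matrix real_of_int (A ** B) = map_matrix real_of_int A ** map_matrix real_of_int B"
  by (simp add: vec_eq_iff map_matrix_def matrix_matrix_mult_def)

lemma map_W_contract: "map_matrix real_of_int (W \<eta>) *v contract \<eta> x = x"
  by (auto simp: vec_eq_iff forall_2 W_def map_matrix_def matrix_vector_mult_def sum_2)

lemma map_W_word_contract_word: "map_matrix real_of_int (W_word w) *v contract_word w x = x"
proof (induction w arbitrary: x)
  case Nil
  have "map_matrix real_of_int (mat 1 :: int^2^2) = mat 1"
    by (simp add: vec_eq_iff map_matrix_def mat_def)
  then show ?case by (simp add: W_word_simps)
next
  case (Cons \<eta> w)
  then show ?case
    by (simp add: W_word_simps map_matrix_mult map_W_contract flip: matrix_vector_mul_assoc)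
qed

lemma map_W_word_right_inverse:
  "map_matrix real_of_int (W_word w) ** matrix (contract_word w) = mat 1"
  by (simp add: matrix_eq matrix_works linear_contract_word map_W_word_contract_word
      flip: matrix_vector_mul_assoc)

lemma contract_word_map_W_word:
  "contract_word w (map_matrix real_of_int (W_word w) *v x) = x"
proof -
  let ?R = "map_matrix real_of_int (W_word w)"
  from map_W_word_right_inverse[of w] have "matrix (contract_word w) ** ?R = mat 1"
    by (simp add: matrix_left_right_inverse)
  then have "matrix (contract_word w) *v (?R *v x) = x"
    by (simp add: matrix_vector_mul_assoc)
  then show ?thesis by (simp add: matrix_works linear_contract_word)
qed

lemma matrix_inv_W_word:
  "matrix_inv (map_matrix real_of_int (W_word w)) *v x = contract_word w x"
proof -
  let ?R = "map_matrix real_of_int (W_word w)"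
  from map_W_word_right_inverse[of w] have "invertible ?R"
    using invertible_right_inverse by blast
  then have "matrix_inv ?R ** ?R = mat 1"
    unfolding invertible_def matrix_inv_def by (rule someI2_ex) simp
  then have "matrix_inv ?R *v (?R *v contract_word w x) = contract_word w x"
    by (simp add: matrix_vector_mul_assoc)
  then show ?thesis
    by (simp add: map_W_word_contract_word)
qed

definition vfloor :: "real^2 \<Rightarrow> int^2" where
  "vfloor x = (\<chi> i. \<lfloor>x $ i\<rfloor>)"

lemma vfloor_emb [simp]: "vfloor (emb \<alpha>) = \<alpha>"
  by (simp add: vfloor_def vec_eq_iff)

lemma infnorm_vfloor: "infnorm (x - emb (vfloor x)) \<le> 1"
proof -
  have "\<bar>x $ i - real_of_int \<lfloor>x $ i\<rfloor>\<bar> \<le> 1" for i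
    by linarith
  then show ?thesis by (simp add: infnorm_2 vfloor_def)
qed

definition int_box :: "real \<Rightarrow> (int^2) set" where
  "int_box L = {\<beta>. infnorm (emb \<beta>) \<le> L}"

lemma finite_int_box: "finite (int_box L)"
proof -
  let ?m = "\<lceil>L\<rceil>"
  have "int_box L \<subseteq> (\<lambda>(x, y). vector [x, y]) ` ({-?m..?m} \<times> {-?m..?m})"
  proof
    fix \<beta> assume "\<beta> \<in> int_box L"
    then have "\<bar>real_of_int (\<beta> $ 1)\<bar> \<le> L" "\<bar>real_of_int (\<beta> $ 2)\<bar> \<le> L"
      by (auto simp: int_box_def infnorm_2)
    then have "\<beta> $ 1 \<in> {-?m..?m}" "\<beta> $ 2 \<in> {-?m..?m}"
      by (auto simp: le_ceiling_iff) linarith+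
    moreover have "\<beta> = vector [\<beta> $ 1, \<beta> $ 2]"
      by (simp add: vec_eq_iff forall_2)
    ultimately show "\<beta> \<in> (\<lambda>(x, y). vector [x, y]) ` ({-?m..?m} \<times> {-?m..?m})"
      by (auto intro!: image_eqI[of _ _ "(\<beta> $ 1, \<beta> $ 2)"])
  qed
  then show ?thesis
    by (rule finite_subset) simp
qed

section \<open>Subdivision operators and their locality\<close>

lemma subdiv_word_simps:
  "subdiv_word a [] c = c"
  "subdiv_word a (\<eta> # w) c = subdiv_word a w (subdiv a \<eta> c)"
  by (simp_all add: subdiv_word_def)

lemma subdiv_word_append: "subdiv_word a (u @ w) c = subdiv_word a w (subdiv_word a u c)"
  by (simp add: subdiv_word_def)

lemma finite_W_preimage:
  assumes "finite S"
  shows "finite {\<beta>. \<alpha> - W \<eta> *v \<beta> \<in> S}"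
proof (rule finite_imageD)
  show "finite ((\<lambda>\<beta>. \<alpha> - W \<eta> *v \<beta>) ` {\<beta>. \<alpha> - W \<eta> *v \<beta> \<in> S})"
    by (rule finite_subset[OF _ assms]) auto
  show "inj_on (\<lambda>\<beta>. \<alpha> - W \<eta> *v \<beta>) {\<beta>. \<alpha> - W \<eta> *v \<beta> \<in> S}"
    by (auto simp: inj_on_def inj_W)
qed

lemma subdiv_lincomb: "subdiv a \<eta> (\<lambda>\<beta>. s * c \<beta> + t * d \<beta>) \<alpha> = s * subdiv a \<eta> c \<alpha> + t * subdiv a \<eta> d \<alpha>"
  by (simp add: subdiv_def sum.distrib sum_distrib_left algebra_simps)

lemma subdiv_word_lincomb:
  "subdiv_word a w (\<lambda>\<beta>. s * c \<beta> + t * d \<beta>) = (\<lambda>\<alpha>. s * subdiv_word a w c \<alpha> + t * subdiv_word a w d \<alpha>)"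
  by (induction w arbitrary: c d) (simp_all add: subdiv_word_simps subdiv_lincomb[abs_def])

lemma subdiv_word_zero: "subdiv_word a w (\<lambda>_. 0) = (\<lambda>_. 0)"
  using subdiv_word_lincomb[of a w 0 "\<lambda>_. 0" 0 "\<lambda>_. 0"] by simp

lemma subdiv_word_sum:
  assumes "finite F"
  shows "subdiv_word a w (\<lambda>\<beta>. \<Sum>\<gamma>\<in>F. s \<gamma> * c \<gamma> \<beta>) = (\<lambda>\<alpha>. \<Sum>\<gamma>\<in>F. s \<gamma> * subdiv_word a w (c \<gamma>) \<alpha>)"
  using assms
proof (induction F)
  case (insert x F)
  then show ?case
    using subdiv_word_lincomb[of a w "s x" "c x" 1 "\<lambda>\<beta>. \<Sum>\<gamma>\<in>F. s \<gamma> * c \<gamma> \<beta>"] by simp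
qed (simp add: subdiv_word_zero)

lemma subdiv_shift: "subdiv a \<eta> (\<lambda>\<beta>. c (\<beta> - \<gamma>)) \<alpha> = subdiv a \<eta> c (\<alpha> - W \<eta> *v \<gamma>)"
  unfolding subdiv_def
  by (rule sum.reindex_bij_witness[of _ "\<lambda>\<beta>. \<beta> + \<gamma>" "\<lambda>\<beta>. \<beta> - \<gamma>"])
     (auto simp: algebra_simps matrix_vector_mult_diff_distrib matrix_vector_right_distrib)

lemma subdiv_word_shift:
  "subdiv_word a w (\<lambda>\<beta>. c (\<beta> - \<gamma>)) = (\<lambda>\<alpha>. subdiv_word a w c (\<alpha> - W_word w *v \<gamma>))"
  by (induction w arbitrary: c \<gamma>)
     (simp_all add: subdiv_word_simps W_word_simps(1) subdiv_shift[abs_def] W_word_Cons_mult)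

text \<open>
  Any bound for the points \<open>W\<^sub>\<eta>\<^sup>-\<^sup>1 \<gamma>\<close>, \<open>\<gamma>\<close> in the support of \<open>a\<^sub>\<eta>\<close>, would do; the sum over the two
  finite supports is one.
\<close>

definition radius :: "(bit \<Rightarrow> int^2 \<Rightarrow> real) \<Rightarrow> real" where
  "radius a = (\<Sum>\<eta>\<in>{0, 1}. \<Sum>\<gamma> | a \<eta> \<gamma> \<noteq> 0. infnorm (contract \<eta> (emb \<gamma>)))"

lemma radius_nonneg: "radius a \<ge> 0"
  unfolding radius_def by (intro sum_nonneg infnorm_pos_le)

text \<open>
  A finite set of lattice points around \<open>W\<^sub>w\<^sup>-\<^sup>1 \<alpha>\<close> with a cardinality that depends neither on \<open>w\<close> nor on
  \<open>\<alpha>\<close>. The margin 2 over the dependency radius pays for rounding to a lattice point and for moving \<open>\<alpha>\<close>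
  to a neighbour.
\<close>

definition window :: "(bit \<Rightarrow> int^2 \<Rightarrow> real) \<Rightarrow> bit list \<Rightarrow> int^2 \<Rightarrow> (int^2) set" where
  "window a w \<alpha> = (+) (vfloor (contract_word w (emb \<alpha>))) ` int_box (4 * radius a + 2)"

lemma finite_window: "finite (window a w \<alpha>)"
  by (simp add: window_def finite_int_box)

lemma card_window: "card (window a w \<alpha>) = card (int_box (4 * radius a + 2))"
  by (simp add: window_def card_image)

lemma window_near:
  assumes "infnorm (emb \<beta> - contract_word w (emb \<alpha>)) \<le> 4 * radius a + 1"
  shows "\<beta> \<in> window a w \<alpha>"
proof -
  let ?x = "contract_word w (emb \<alpha>)"
  have "emb (\<beta> - vfloor ?x) = (emb \<beta> - ?x) + (?x - emb (vfloor ?x))"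
    by (simp add: emb_arith)
  also have "infnorm \<dots> \<le> (4 * radius a + 1) + 1"
    by (intro order_trans[OF infnorm_triangle] add_mono assms infnorm_vfloor)
  finally have "\<beta> - vfloor ?x \<in> int_box (4 * radius a + 2)"
    by (simp add: int_box_def)
  then show ?thesis
    unfolding window_def by (intro image_eqI[where x = "\<beta> - vfloor ?x"]) simp_all
qed

context
  fixes a :: "bit \<Rightarrow> int^2 \<Rightarrow> real"
  assumes mask: "\<And>\<eta>. finite {\<alpha>. a \<eta> \<alpha> \<noteq> 0}"
begin

lemma finite_stencil: "finite {\<beta>. a \<eta> (\<alpha> - W \<eta> *v \<beta>) \<noteq> 0}"
  using finite_W_preimage[OF mask, of \<alpha> \<eta> \<eta>] by simp

lemma subdiv_eq:
  assumes "finite F" "\<And>\<beta>. a \<eta> (\<alpha> - W \<eta> *v \<beta>) \<noteq> 0 \<Longrightarrow> \<beta> \<in> F \<or> c \<beta> = 0"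
  shows "subdiv a \<eta> c \<alpha> = (\<Sum>\<beta>\<in>F. a \<eta> (\<alpha> - W \<eta> *v \<beta>) * c \<beta>)"
proof -
  have "subdiv a \<eta> c \<alpha> = (\<Sum>\<beta>\<in>{\<beta>. a \<eta> (\<alpha> - W \<eta> *v \<beta>) \<noteq> 0} \<union> F. a \<eta> (\<alpha> - W \<eta> *v \<beta>) * c \<beta>)"
    unfolding subdiv_def using assms(1) finite_stencil by (intro sum.mono_neutral_left) auto
  also have "\<dots> = (\<Sum>\<beta>\<in>F. a \<eta> (\<alpha> - W \<eta> *v \<beta>) * c \<beta>)"
    using assms finite_stencil by (intro sum.mono_neutral_right) auto
  finally show ?thesis .
qed

lemma subdiv_delta: "subdiv a \<eta> delta = a \<eta>"
  by (rule ext, subst subdiv_eq[of "{0}"]) (auto simp: delta_def split: if_splits)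

lemma stencil_radius:
  assumes "a \<eta> (\<alpha> - W \<eta> *v \<beta>) \<noteq> 0"
  shows "infnorm (emb \<beta> - contract \<eta> (emb \<alpha>)) \<le> radius a"
proof -
  let ?\<gamma> = "\<alpha> - W \<eta> *v \<beta>"
  have "infnorm (emb \<beta> - contract \<eta> (emb \<alpha>)) = infnorm (contract \<eta> (emb ?\<gamma>))"
    by (simp add: emb_arith linear_diff[OF linear_contract] contract_W infnorm_sub)
  also have "\<dots> \<le> (\<Sum>\<gamma> | a \<eta> \<gamma> \<noteq> 0. infnorm (contract \<eta> (emb \<gamma>)))"
    using assms mask by (intro member_le_sum) (auto simp: infnorm_pos_le)
  also have "\<dots> \<le> radius a"
    unfolding radius_def
    by (intro member_le_sum[where f = "\<lambda>\<eta>. \<Sum>\<gamma> | a \<eta> \<gamma> \<noteq> 0. infnorm (contract \<eta> (emb \<gamma>))"]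
        sum_nonneg) (auto simp: infnorm_pos_le)
  finally show ?thesis .
qed

text \<open>
  One subdivision step looks within distance \<^term>\<open>radius a\<close> of \<open>W\<^sub>\<eta>\<^sup>-\<^sup>1 \<alpha>\<close>. Pulling back through the next
  step shrinks the accumulated distance \<open>\<rho>\<close> by 3/4 and adds the radius, and the fixed point of
  \<open>\<rho> \<mapsto> radius + 3/4 \<rho>\<close> is four times the radius. So the dependency region has a size
  that does not grow with the length of the word.
\<close>

lemma subdiv_word_local:
  assumes "\<And>\<beta>. infnorm (emb \<beta> - contract_word w (emb \<alpha>)) \<le> 4 * radius a \<Longrightarrow> c \<beta> = d \<beta>"
  shows "subdiv_word a w c \<alpha> = subdiv_word a w d \<alpha>"
  using assms
proof (induction w arbitrary: c d)
  case Nil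
  then show ?case using radius_nonneg by (simp add: subdiv_word_simps infnorm_0)
next
  case (Cons \<eta> w)
  have "subdiv_word a w (subdiv a \<eta> c) \<alpha> = subdiv_word a w (subdiv a \<eta> d) \<alpha>"
  proof (rule Cons.IH)
    fix \<beta> assume \<beta>: "infnorm (emb \<beta> - contract_word w (emb \<alpha>)) \<le> 4 * radius a"
    have "c \<gamma> = d \<gamma>" if "a \<eta> (\<beta> - W \<eta> *v \<gamma>) \<noteq> 0" for \<gamma>
    proof (rule Cons.prems)
      have "emb \<gamma> - contract_word (\<eta> # w) (emb \<alpha>) =
          (emb \<gamma> - contract \<eta> (emb \<beta>)) + contract \<eta> (emb \<beta> - contract_word w (emb \<alpha>))"
        by (simp add: linear_diff[OF linear_contract])
      also have "infnorm \<dots> \<le> radius a + 3 / 4 * (4 * radius a)"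
        using stencil_radius[OF that] \<beta>
        by (intro order_trans[OF infnorm_triangle] add_mono order_trans[OF infnorm_contract]) auto
      finally show "infnorm (emb \<gamma> - contract_word (\<eta> # w) (emb \<alpha>)) \<le> 4 * radius a" by simp
    qed
    then show "subdiv a \<eta> c \<beta> = subdiv a \<eta> d \<beta>"
      by (auto simp: subdiv_def intro!: sum.cong)
  qed
  then show ?case by (simp add: subdiv_word_simps)
qed

lemma subdiv_word_expand:
  assumes "finite F"
    and "\<And>\<beta>. infnorm (emb \<beta> - contract_word w (emb \<alpha>)) \<le> 4 * radius a \<Longrightarrow> \<beta> \<in> F"
  shows "subdiv_word a w c \<alpha> = (\<Sum>\<beta>\<in>F. c \<beta> * subdiv_word a w delta (\<alpha> - W_word w *v \<beta>))"
proof -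
  have "subdiv_word a w c \<alpha> = subdiv_word a w (\<lambda>\<beta>. \<Sum>\<gamma>\<in>F. c \<gamma> * delta (\<beta> - \<gamma>)) \<alpha>"
  proof (rule subdiv_word_local)
    fix \<beta> assume "infnorm (emb \<beta> - contract_word w (emb \<alpha>)) \<le> 4 * radius a"
    then have "\<beta> \<in> F" by (rule assms)
    have "(\<Sum>\<gamma>\<in>F. c \<gamma> * delta (\<beta> - \<gamma>)) = (\<Sum>\<gamma>\<in>F. if \<beta> = \<gamma> then c \<gamma> else 0)"
      by (intro sum.cong) (auto simp: delta_def)
    then show "c \<beta> = (\<Sum>\<gamma>\<in>F. c \<gamma> * delta (\<beta> - \<gamma>))"
      using \<open>\<beta> \<in> F\<close> assms(1) by simp
  qed
  then show ?thesis
    by (simp add: subdiv_word_sum[OF assms(1)] subdiv_word_shift)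
qed

end

section \<open>Steps of a sequence and their growth under subdivision\<close>

text \<open>
  This is the bound \<open>\<parallel>\<nabla>c\<parallel>\<^sub>\<infinity> \<le> m\<close>, in a form that makes sense for unbounded \<open>c\<close> as well.
\<close>

definition step_bound :: "(int^2 \<Rightarrow> real) \<Rightarrow> real \<Rightarrow> bool" where
  "step_bound c m \<longleftrightarrow> (\<forall>\<alpha> j. \<bar>c (\<alpha> - axis j 1) - c \<alpha>\<bar> \<le> m)"

lemma step_bound_nonneg: "step_bound c m \<Longrightarrow> 0 \<le> m"
  unfolding step_bound_def by (meson abs_ge_zero order_trans)

lemma step_bound_axis:
  assumes "step_bound c m"
  shows "\<bar>c (\<alpha> + k *s axis j 1) - c \<alpha>\<bar> \<le> real_of_int \<bar>k\<bar> * m"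
proof -
  have pos: "\<bar>c (\<alpha> + int n *s axis j 1) - c \<alpha>\<bar> \<le> real n * m" for n \<alpha>
  proof (induction n)
    case (Suc n)
    have "\<alpha> + int (Suc n) *s axis j 1 - axis j 1 = \<alpha> + int n *s axis j 1"
      by (simp add: vec_eq_iff axis_def algebra_simps)
    then have "\<bar>c (\<alpha> + int n *s axis j 1) - c (\<alpha> + int (Suc n) *s axis j 1)\<bar> \<le> m"
      using assms unfolding step_bound_def by metis
    with Suc show ?case by (simp add: algebra_simps)
  qed simp
  show ?thesis
  proof (cases "k \<ge> 0")
    case True
    then show ?thesis using pos[of \<alpha> "nat k"] by simp
  next
    case False
    then have "\<alpha> + k *s axis j 1 + int (nat (- k)) *s axis j 1 = \<alpha>"
      by (simp add: vec_eq_iff)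
    with pos[of "\<alpha> + k *s axis j 1" "nat (- k)"]
    have "\<bar>c \<alpha> - c (\<alpha> + k *s axis j 1)\<bar> \<le> real (nat (- k)) * m" by metis
    then show ?thesis
      using False by (simp add: abs_minus_commute)
  qed
qed

lemma step_bound_infnorm:
  assumes "step_bound c m"
  shows "\<bar>c \<beta> - c \<alpha>\<bar> \<le> 2 * infnorm (emb \<beta> - emb \<alpha>) * m"
proof -
  define k where "k i = \<beta> $ i - \<alpha> $ i" for i
  define \<gamma> where "\<gamma> = \<alpha> + k 1 *s axis 1 1"
  have \<beta>: "\<beta> = \<gamma> + k 2 *s axis 2 1"
    by (simp add: vec_eq_iff forall_2 \<gamma>_def k_def axis_def)
  have m: "0 \<le> m" using assms by (rule step_bound_nonneg)
  have k: "real_of_int \<bar>k i\<bar> \<le> infnorm (emb \<beta> - emb \<alpha>)" for i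
    using component_le_infnorm_cart[of "emb \<beta> - emb \<alpha>" i] by (simp add: k_def)
  have "\<bar>c \<beta> - c \<alpha>\<bar> \<le> \<bar>c \<beta> - c \<gamma>\<bar> + \<bar>c \<gamma> - c \<alpha>\<bar>" by linarith
  also have "\<dots> \<le> real_of_int \<bar>k 2\<bar> * m + real_of_int \<bar>k 1\<bar> * m"
    unfolding \<beta> \<gamma>_def by (intro add_mono step_bound_axis assms)
  also have "\<dots> \<le> infnorm (emb \<beta> - emb \<alpha>) * m + infnorm (emb \<beta> - emb \<alpha>) * m"
    using k m by (intro add_mono mult_right_mono) auto
  finally show ?thesis by (simp add: mult_ac)
qed

lemma subdiv_word_const:
  assumes "\<And>\<eta>. subdiv a \<eta> (\<lambda>_. 1) = (\<lambda>_. 1)"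
  shows "subdiv_word a w (\<lambda>_. t) = (\<lambda>_. t)"
proof -
  have "subdiv_word a w (\<lambda>_. 1) = (\<lambda>_. 1)"
    by (induction w) (simp_all add: subdiv_word_simps assms)
  then show ?thesis
    using subdiv_word_lincomb[of a w t "\<lambda>_. 1" 0 "\<lambda>_. 1"] by simp
qed

context
  fixes a :: "bit \<Rightarrow> int^2 \<Rightarrow> real"
  assumes mask: "\<And>\<eta>. finite {\<alpha>. a \<eta> \<alpha> \<noteq> 0}"
    and const: "\<And>\<eta>. subdiv a \<eta> (\<lambda>_. 1) = (\<lambda>_. 1)"
begin

text \<open>
  A step of \<open>S\<^sub>w c\<close> does not change when a constant is subtracted from \<open>c\<close>, since constants are reproduced.
  Subtracting a nearby value of \<open>c\<close> leaves values of the order of the steps of \<open>c\<close> on the window, and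
  each of these is weighted with a step of \<open>S\<^sub>w \<delta>\<close>. The constant counts the points of the window and is
  therefore independent of \<open>w\<close>, which is what makes this bound useful for long words.
\<close>

lemma step_bound_subdiv_word:
  obtains C where "C \<ge> 0"
    "\<And>w c m q. step_bound c m \<Longrightarrow> step_bound (subdiv_word a w delta) q \<Longrightarrow>
        step_bound (subdiv_word a w c) (C * q * m)"
proof -
  define L where "L = 4 * radius a + 2"
  define C where "C = real (card (int_box L)) * (2 * L)"
  have L: "0 \<le> L" using radius_nonneg by (simp add: L_def)
  have "step_bound (subdiv_word a w c) (C * q * m)"
    if c: "step_bound c m" and w: "step_bound (subdiv_word a w delta) q" for w c m q
    unfolding step_bound_def
  proof (intro allI)
    fix \<alpha> :: "int^2" and j :: 2
    let ?F = "window a w \<alpha>" and ?s = "subdiv_word a w delta"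
    define \<beta>\<^sub>0 where "\<beta>\<^sub>0 = vfloor (contract_word w (emb \<alpha>))"
    define d where "d = (\<lambda>\<beta>. c \<beta> - c \<beta>\<^sub>0)"
    have m: "0 \<le> m" and q: "0 \<le> q" using c w step_bound_nonneg by auto
    have dc: "subdiv_word a w c \<alpha>' = subdiv_word a w d \<alpha>' + c \<beta>\<^sub>0" for \<alpha>'
      using subdiv_word_lincomb[of a w 1 d "c \<beta>\<^sub>0" "\<lambda>_. 1"]
      by (simp add: subdiv_word_const[of a, OF const] d_def)
    have near: "\<beta> \<in> ?F"
      if "infnorm (emb \<beta> - contract_word w (emb \<alpha>')) \<le> 4 * radius a" and "\<alpha>' = \<alpha> \<or> \<alpha>' = \<alpha> - axis j 1" for \<beta> \<alpha>'
    proof (rule window_near)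
      have "infnorm (emb \<alpha>' - emb \<alpha>) \<le> 1"
        using that(2) by (auto simp: infnorm_2 axis_def)
      then have 1: "infnorm (contract_word w (emb \<alpha>' - emb \<alpha>)) \<le> 1"
        using infnorm_contract_word_le order_trans by blast
      have "emb \<beta> - contract_word w (emb \<alpha>) =
          (emb \<beta> - contract_word w (emb \<alpha>')) + contract_word w (emb \<alpha>' - emb \<alpha>)"
        by (simp add: linear_diff[OF linear_contract_word])
      also have "infnorm \<dots> \<le> 4 * radius a + 1"
        by (intro order_trans[OF infnorm_triangle] add_mono that(1) 1)
      finally show "infnorm (emb \<beta> - contract_word w (emb \<alpha>)) \<le> 4 * radius a + 1" .
    qed
    have exp: "subdiv_word a w d \<alpha>' = (\<Sum>\<beta>\<in>?F. d \<beta> * ?s (\<alpha>' - W_word w *v \<beta>))"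
      if "\<alpha>' = \<alpha> \<or> \<alpha>' = \<alpha> - axis j 1" for \<alpha>'
      by (rule subdiv_word_expand[OF mask finite_window]) (rule near, use that in auto)
    have "subdiv_word a w c (\<alpha> - axis j 1) - subdiv_word a w c \<alpha> =
        (\<Sum>\<beta>\<in>?F. d \<beta> * (?s (\<alpha> - W_word w *v \<beta> - axis j 1) - ?s (\<alpha> - W_word w *v \<beta>)))"
      by (simp add: dc exp algebra_simps flip: sum_subtractf)
    also have "\<bar>\<dots>\<bar> \<le> (\<Sum>\<beta>\<in>?F. (2 * L * m) * q)"
    proof (rule order_trans[OF sum_abs], rule sum_mono)
      fix \<beta> assume "\<beta> \<in> ?F"
      then have "infnorm (emb \<beta> - emb \<beta>\<^sub>0) \<le> L"
        by (auto simp: window_def \<beta>\<^sub>0_def L_def int_box_def emb_arith)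
      then have "\<bar>d \<beta>\<bar> \<le> 2 * L * m"
        using step_bound_infnorm[OF c, of \<beta> \<beta>\<^sub>0] m unfolding d_def
        by (elim order_trans) (intro mult_right_mono, auto)
      moreover have "\<bar>?s (\<alpha> - W_word w *v \<beta> - axis j 1) - ?s (\<alpha> - W_word w *v \<beta>)\<bar> \<le> q"
        using w by (simp add: step_bound_def)
      ultimately show "\<bar>d \<beta> * (?s (\<alpha> - W_word w *v \<beta> - axis j 1) - ?s (\<alpha> - W_word w *v \<beta>))\<bar> \<le> (2 * L * m) * q"
        unfolding abs_mult by (intro mult_mono) (use L m in auto)
    qed
    also have "\<dots> = C * q * m"
      by (simp add: card_window C_def L_def)
    finally show "\<bar>subdiv_word a w c (\<alpha> - axis j 1) - subdiv_word a w c \<alpha>\<bar> \<le> C * q * m" .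
  qed
  moreover have "C \<ge> 0" using L by (simp add: C_def)
  ultimately show ?thesis using that by blast
qed

end

section \<open>Coset sums, the ideal I and representation masks\<close>

text \<open>
  Both \<open>W\<^sub>0 \<int>\<^sup>2\<close> and \<open>W\<^sub>1 \<int>\<^sup>2\<close> equal \<open>4\<int> \<times> 2\<int>\<close>, so one ideal and one notion of coset serve both masks.
\<close>

definition lattice :: "(int^2) set" where
  "lattice = {\<alpha>. 4 dvd \<alpha> $ 1 \<and> 2 dvd \<alpha> $ 2}"

lemma lattice_iff: "\<alpha> \<in> lattice \<longleftrightarrow> (\<exists>\<beta>. \<alpha> = W \<eta> *v \<beta>)"
proof
  assume "\<alpha> \<in> lattice"
  then obtain k l where kl: "\<alpha> $ 1 = 4 * k" "\<alpha> $ 2 = 2 * l"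
    by (auto simp: lattice_def elim!: dvdE)
  have "\<alpha> = W \<eta> *v vector [k + (if \<eta> = 0 then 0 else l), l]"
    by (auto simp: vec_eq_iff forall_2 kl)
  then show "\<exists>\<beta>. \<alpha> = W \<eta> *v \<beta>" by blast
next
  assume "\<exists>\<beta>. \<alpha> = W \<eta> *v \<beta>"
  then show "\<alpha> \<in> lattice"
    by (auto simp: lattice_def)
qed

lemma W_mult_axis: "W \<eta> *v axis k 1 = column k (W \<eta>)"
  by (simp add: vec_eq_iff matrix_vector_mult_def column_def axis_def if_distrib sum.delta cong: if_cong)

lemma lattice_diff: "\<alpha> \<in> lattice \<Longrightarrow> \<beta> \<in> lattice \<Longrightarrow> \<alpha> - \<beta> \<in> lattice"
  by (simp add: lattice_def)

lemma lattice_0: "0 \<in> lattice"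
  by (simp add: lattice_def)

lemma lattice_add: "\<alpha> \<in> lattice \<Longrightarrow> \<beta> \<in> lattice \<Longrightarrow> \<alpha> + \<beta> \<in> lattice"
  by (simp add: lattice_def)

definition residue :: "int^2 \<Rightarrow> int^2" where
  "residue \<gamma> = vector [\<gamma> $ 1 mod 4, \<gamma> $ 2 mod 2]"

definition residues :: "(int^2) set" where
  "residues = (\<lambda>(i, j). vector [i, j]) ` ({0..3} \<times> {0..1})"

lemma finite_residues: "finite residues" and card_residues: "card residues = 8"
proof -
  have "inj_on (\<lambda>(i, j). vector [i, j] :: int^2) ({0..3} \<times> {0..1})"
    by (rule inj_onI) (auto simp: vec_eq_iff forall_2)
  then show "card residues = 8"
    by (simp add: residues_def card_image)
qed (simp add: residues_def)

lemma residue_in: "residue \<gamma> \<in> residues"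
proof -
  have "(\<gamma> $ 1 mod 4, \<gamma> $ 2 mod 2) \<in> {0..3} \<times> {0..1}"
    using pos_mod_bound[of 4 "\<gamma> $ 1"] pos_mod_bound[of 2 "\<gamma> $ 2"] by auto
  then show ?thesis
    unfolding residues_def residue_def
    by (rule image_eqI[where x = "(\<gamma> $ 1 mod 4, \<gamma> $ 2 mod 2)", rotated]) simp
qed

lemma residue_eq_iff: "\<delta> \<in> residues \<Longrightarrow> residue \<gamma> = \<delta> \<longleftrightarrow> \<delta> - \<gamma> \<in> lattice"
proof -
  assume "\<delta> \<in> residues"
  then have \<delta>: "\<delta> $ 1 mod 4 = \<delta> $ 1" "\<delta> $ 2 mod 2 = \<delta> $ 2"
    by (auto simp: residues_def)
  have "residue \<gamma> = \<delta> \<longleftrightarrow> \<gamma> $ 1 mod 4 = \<delta> $ 1 mod 4 \<and> \<gamma> $ 2 mod 2 = \<delta> $ 2 mod 2"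
    by (simp add: residue_def vec_eq_iff forall_2 \<delta>)
  also have "\<dots> \<longleftrightarrow> \<delta> - \<gamma> \<in> lattice"
    unfolding lattice_def by (auto simp: mod_eq_dvd_iff dvd_diff_commute)
  finally show ?thesis .
qed

definition coset_sum :: "laurent \<Rightarrow> int^2 \<Rightarrow> real" where
  "coset_sum p \<alpha> = (\<Sum>\<gamma>\<in>Poly_Mapping.keys p. of_bool (\<alpha> - \<gamma> \<in> lattice) * Poly_Mapping.lookup p \<gamma>)"

lemma coset_sum_eq:
  assumes "finite F" "Poly_Mapping.keys p \<subseteq> F"
  shows "coset_sum p \<alpha> = (\<Sum>\<gamma>\<in>F. of_bool (\<alpha> - \<gamma> \<in> lattice) * Poly_Mapping.lookup p \<gamma>)"
  unfolding coset_sum_def using assms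
  by (intro sum.mono_neutral_left) (auto simp: in_keys_iff)

lemma coset_sum_add: "coset_sum (p + q) \<alpha> = coset_sum p \<alpha> + coset_sum q \<alpha>"
proof -
  let ?F = "Poly_Mapping.keys p \<union> Poly_Mapping.keys q"
  have "coset_sum r \<alpha> = (\<Sum>\<gamma>\<in>?F. of_bool (\<alpha> - \<gamma> \<in> lattice) * Poly_Mapping.lookup r \<gamma>)"
    if "Poly_Mapping.keys r \<subseteq> ?F" for r
    using that by (intro coset_sum_eq) auto
  from this[of p] this[of q] this[of "p + q"] show ?thesis
    using keys_add[of p q] by (simp add: lookup_add algebra_simps sum.distrib)
qed

lemma coset_sum_0 [simp]: "coset_sum 0 \<alpha> = 0"
  by (simp add: coset_sum_def)

lemma coset_sum_uminus: "coset_sum (- p) \<alpha> = - coset_sum p \<alpha>"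
  using coset_sum_add[of p "- p" \<alpha>] by simp

lemma coset_sum_diff: "coset_sum (p - q) \<alpha> = coset_sum p \<alpha> - coset_sum q \<alpha>"
  using coset_sum_add[of p "- q" \<alpha>] by (simp add: coset_sum_uminus)

lemma coset_sum_sum: "coset_sum (sum p F) \<alpha> = (\<Sum>i\<in>F. coset_sum (p i) \<alpha>)"
  by (induction F rule: infinite_finite_induct) (simp_all add: coset_sum_add)

lemma coset_sum_single: "coset_sum (Poly_Mapping.single x v) \<alpha> = of_bool (\<alpha> - x \<in> lattice) * v"
  by (subst coset_sum_eq[of "{x}"]) auto

lemma sum_monomials: "p = (\<Sum>\<gamma>\<in>Poly_Mapping.keys p. Poly_Mapping.single \<gamma> (Poly_Mapping.lookup p \<gamma>))"
  by (rule poly_mapping_eqI)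
     (simp add: lookup_sum lookup_single when_def in_keys_iff sum.delta)

lemma coset_sum_zpow_mult: "coset_sum (zpow x * p) \<alpha> = coset_sum p (\<alpha> - x)"
proof -
  have "zpow x * p = (\<Sum>\<gamma>\<in>Poly_Mapping.keys p. Poly_Mapping.single (x + \<gamma>) (Poly_Mapping.lookup p \<gamma>))"
    by (subst sum_monomials[of p]) (simp add: zpow_def sum_distrib_left mult_single)
  then have "coset_sum (zpow x * p) \<alpha> =
      (\<Sum>\<gamma>\<in>Poly_Mapping.keys p. of_bool (\<alpha> - x - \<gamma> \<in> lattice) * Poly_Mapping.lookup p \<gamma>)"
    by (simp only: coset_sum_sum coset_sum_single diff_diff_eq)
  then show ?thesis
    by (simp only: coset_sum_def[of p])
qed

lemma lookup_zpow_mult: "Poly_Mapping.lookup (zpow x * p) \<alpha> = Poly_Mapping.lookup p (\<alpha> - x)"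
proof -
  have "zpow x * p = (\<Sum>\<gamma>\<in>Poly_Mapping.keys p. Poly_Mapping.single (x + \<gamma>) (Poly_Mapping.lookup p \<gamma>))"
    by (subst sum_monomials[of p]) (simp add: zpow_def sum_distrib_left mult_single)
  then have "Poly_Mapping.lookup (zpow x * p) \<alpha> =
    (\<Sum>\<gamma>\<in>Poly_Mapping.keys p. if \<gamma> = \<alpha> - x then Poly_Mapping.lookup p \<gamma> else 0)"
    by (auto simp: lookup_sum lookup_single when_def algebra_simps intro!: sum.cong)
  then show ?thesis
    by (simp add: in_keys_iff)
qed

lemma zpow_add: "zpow (x + y) = zpow x * zpow y"
  by (simp add: zpow_def mult_single)

lemma zpow_0 [simp]: "zpow 0 = 1"
  by (simp add: zpow_def)

text \<open>
  The ideal \<open>\<langle>z\<^sup>W - 1\<rangle>\<close> of which \<^const>\<open>I\<close> is a quotient.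
\<close>

abbreviation lattice_ideal :: "laurent set" where
  "lattice_ideal \<equiv> ideal2 (zpow (column 1 (W 0)) - 1) (zpow (column 2 (W 0)) - 1)"

lemma ideal2_gen: "f \<in> ideal2 f g" "g \<in> ideal2 f g"
proof -
  have "f = 1 * f + 0 * g" "g = 0 * f + 1 * g" by simp_all
  then show "f \<in> ideal2 f g" "g \<in> ideal2 f g"
    unfolding ideal2_def by blast+
qed

lemma ideal2_0: "0 \<in> ideal2 f g"
proof -
  have "0 = 0 * f + 0 * g" by simp
  then show ?thesis
    unfolding ideal2_def by blast
qed

lemma ideal2_add: "p \<in> ideal2 f g \<Longrightarrow> q \<in> ideal2 f g \<Longrightarrow> p + q \<in> ideal2 f g"
proof -
  assume "p \<in> ideal2 f g" "q \<in> ideal2 f g"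
  then obtain a b c d where "p = a * f + b * g" "q = c * f + d * g"
    unfolding ideal2_def by blast
  then have "p + q = (a + c) * f + (b + d) * g" by (simp add: algebra_simps)
  then show ?thesis unfolding ideal2_def by blast
qed

lemma ideal2_mult: "p \<in> ideal2 f g \<Longrightarrow> h * p \<in> ideal2 f g"
proof -
  assume "p \<in> ideal2 f g"
  then obtain a b where "p = a * f + b * g"
    unfolding ideal2_def by blast
  then have "h * p = (h * a) * f + (h * b) * g" by (simp add: algebra_simps)
  then show ?thesis unfolding ideal2_def by blast
qed

lemma ideal2_sum: "(\<And>i. i \<in> F \<Longrightarrow> p i \<in> ideal2 f g) \<Longrightarrow> sum p F \<in> ideal2 f g"
  by (induction F rule: infinite_finite_induct) (auto intro: ideal2_0 ideal2_add)

lemma zpow_multiple: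
  assumes "zpow x - 1 \<in> ideal2 f g"
  shows "zpow (k *s x) - 1 \<in> ideal2 f g"
proof -
  have pos: "zpow (int n *s x) - 1 \<in> ideal2 f g" for n
  proof (induction n)
    case (Suc n)
    have "int (Suc n) *s x = x + int n *s x"
      by (simp add: vec_eq_iff algebra_simps)
    then have eq: "zpow (int (Suc n) *s x) - 1 = zpow x * (zpow (int n *s x) - 1) + (zpow x - 1)"
      by (simp add: zpow_add algebra_simps)
    show ?case unfolding eq by (intro ideal2_add ideal2_mult Suc assms)
  qed (simp add: ideal2_0)
  show ?thesis
  proof (cases "k \<ge> 0")
    case True
    then show ?thesis using pos[of "nat k"] by simp
  next
    case False
    then have "k *s x + int (nat (- k)) *s x = 0" by (simp add: vec_eq_iff)
    then have "zpow (k *s x) * zpow (int (nat (- k)) *s x) = 1"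
      by (metis zpow_add zpow_0)
    then have "zpow (k *s x) - 1 = (- zpow (k *s x)) * (zpow (int (nat (- k)) *s x) - 1)"
      by (simp add: algebra_simps)
    then show ?thesis using ideal2_mult[OF pos] by metis
  qed
qed

lemma zpow_lattice:
  assumes "\<delta> \<in> lattice"
  shows "zpow \<delta> - 1 \<in> lattice_ideal"
proof -
  obtain \<beta> where "\<delta> = W 0 *v \<beta>" using assms lattice_iff by blast
  then have \<delta>: "\<delta> = \<beta> $ 1 *s column 1 (W 0) + \<beta> $ 2 *s column 2 (W 0)"
    by (simp add: matrix_mult_sum sum_2)
  let ?x = "\<beta> $ 1 *s column 1 (W 0)" and ?y = "\<beta> $ 2 *s column 2 (W 0)"
  have "zpow \<delta> - 1 = zpow ?x * (zpow ?y - 1) + (zpow ?x - 1)"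
    unfolding \<delta> by (simp add: zpow_add algebra_simps)
  also have "\<dots> \<in> lattice_ideal"
    by (intro ideal2_add ideal2_mult zpow_multiple ideal2_gen)
  finally show ?thesis .
qed

text \<open>
  The generators shift by lattice vectors, which preserves coset sums. Conversely, modulo the ideal
  each monomial equals the one whose exponent is the reduced representative of its coset; after this
  reduction the coefficients are the coset sums.
\<close>

lemma lattice_ideal_iff: "f \<in> lattice_ideal \<longleftrightarrow> (\<forall>\<alpha>. coset_sum f \<alpha> = 0)"
proof
  assume "f \<in> lattice_ideal"
  then obtain p q where f: "f = p * (zpow (column 1 (W 0)) - 1) + q * (zpow (column 2 (W 0)) - 1)"
    unfolding ideal2_def by blast
  have "coset_sum (p * (zpow x - 1)) \<alpha> = 0" if "x \<in> lattice" for p x \<alpha>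
  proof -
    have "\<alpha> - x - \<gamma> \<in> lattice \<longleftrightarrow> \<alpha> - \<gamma> \<in> lattice" for \<gamma>
      using lattice_add[OF _ that, of "\<alpha> - x - \<gamma>"] lattice_diff[OF _ that, of "\<alpha> - \<gamma>"]
      by (auto simp: algebra_simps)
    then have "coset_sum p (\<alpha> - x) = coset_sum p \<alpha>"
      by (simp add: coset_sum_def)
    moreover have "p * (zpow x - 1) = zpow x * p - p"
      by (simp add: algebra_simps)
    ultimately show ?thesis
      by (simp add: coset_sum_diff coset_sum_zpow_mult)
  qed
  moreover have "column i (W 0) \<in> lattice" for i
    unfolding lattice_iff[of _ 0] W_mult_axis[symmetric] by blast
  ultimately show "\<forall>\<alpha>. coset_sum f \<alpha> = 0"
    by (simp add: f coset_sum_add)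
next
  assume cs: "\<forall>\<alpha>. coset_sum f \<alpha> = 0"
  let ?l = "Poly_Mapping.lookup f" and ?s = "Poly_Mapping.single :: _ \<Rightarrow> _ \<Rightarrow> laurent"
  have "(\<Sum>\<gamma>\<in>Poly_Mapping.keys f. ?s (residue \<gamma>) (?l \<gamma>)) = 0"
  proof (rule poly_mapping_eqI)
    fix \<delta>
    have "Poly_Mapping.lookup (\<Sum>\<gamma>\<in>Poly_Mapping.keys f. ?s (residue \<gamma>) (?l \<gamma>)) \<delta> =
        (\<Sum>\<gamma>\<in>Poly_Mapping.keys f. of_bool (residue \<gamma> = \<delta>) * ?l \<gamma>)"
      unfolding lookup_sum by (intro sum.cong) (auto simp: lookup_single when_def)
    also have "\<dots> = (if \<delta> \<in> residues then coset_sum f \<delta> else 0)"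
    proof (cases "\<delta> \<in> residues")
      case False
      then have "residue \<gamma> \<noteq> \<delta>" for \<gamma> using residue_in by blast
      with False show ?thesis by simp
    next
      case True
      then show ?thesis by (simp add: coset_sum_def residue_eq_iff)
    qed
    finally show "Poly_Mapping.lookup (\<Sum>\<gamma>\<in>Poly_Mapping.keys f. ?s (residue \<gamma>) (?l \<gamma>)) \<delta> =
        Poly_Mapping.lookup 0 \<delta>"
      using cs by simp
  qed
  then have "f = (\<Sum>\<gamma>\<in>Poly_Mapping.keys f. ?s \<gamma> (?l \<gamma>)) - (\<Sum>\<gamma>\<in>Poly_Mapping.keys f. ?s (residue \<gamma>) (?l \<gamma>))"
    by (simp flip: sum_monomials)
  also have "\<dots> = (\<Sum>\<gamma>\<in>Poly_Mapping.keys f. ?s (residue \<gamma>) (?l \<gamma>) * (zpow (\<gamma> - residue \<gamma>) - 1))"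
    by (simp add: zpow_def right_diff_distrib mult_single sum_subtractf)
  also have "\<dots> \<in> lattice_ideal"
  proof (intro ideal2_sum ideal2_mult zpow_lattice)
    fix \<gamma>
    have "residue \<gamma> - \<gamma> \<in> lattice" using residue_eq_iff residue_in by blast
    then show "\<gamma> - residue \<gamma> \<in> lattice" using lattice_diff[OF lattice_0] by force
  qed
  finally show "f \<in> lattice_ideal" .
qed

lemma coset_sum_zvar: "coset_sum (f * (zvar j - 1)) \<alpha> = coset_sum f (\<alpha> - axis j 1) - coset_sum f \<alpha>"
proof -
  have "f * (zvar j - 1) = zpow (axis j 1) * f - f"
    by (simp add: zvar_def algebra_simps)
  then show ?thesis by (simp add: coset_sum_diff coset_sum_zpow_mult)
qed

text \<open>
  Multiplying by \<open>z\<^sub>j - 1\<close> takes differences of neighbouring coset sums, and a function on \<open>\<int>\<^sup>2\<close> with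
  vanishing steps is constant.
\<close>

lemma I_iff: "f \<in> I \<longleftrightarrow> (\<exists>t. \<forall>\<alpha>. coset_sum f \<alpha> = t)"
proof
  assume f: "f \<in> I"
  have "coset_sum f (\<alpha> - axis j 1) - coset_sum f \<alpha> = 0" for j \<alpha>
  proof -
    have "zvar j - 1 \<in> ideal2 (zvar 1 - 1) (zvar 2 - 1)"
      using exhaust_2[of j] ideal2_gen by auto
    then have "f * (zvar j - 1) \<in> lattice_ideal"
      using f by (simp add: I_def ideal_quotient_def)
    then show ?thesis
      by (simp add: lattice_ideal_iff coset_sum_zvar)
  qed
  then have "step_bound (coset_sum f) 0"
    by (simp add: step_bound_def)
  then have "coset_sum f \<alpha> = coset_sum f 0" for \<alpha>
    using step_bound_infnorm by fastforce
  then show "\<exists>t. \<forall>\<alpha>. coset_sum f \<alpha> = t" by blast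
next
  assume "\<exists>t. \<forall>\<alpha>. coset_sum f \<alpha> = t"
  then have z: "f * (zvar j - 1) \<in> lattice_ideal" for j
    by (auto simp: lattice_ideal_iff coset_sum_zvar)
  show "f \<in> I"
    unfolding I_def ideal_quotient_def
  proof (clarify)
    fix g assume "g \<in> ideal2 (zvar 1 - 1) (zvar 2 - 1)"
    then obtain p q where "g = p * (zvar 1 - 1) + q * (zvar 2 - 1)"
      unfolding ideal2_def by blast
    then have eq: "f * g = p * (f * (zvar 1 - 1)) + q * (f * (zvar 2 - 1))"
      by (simp only: distrib_left mult.left_commute)
    show "f * g \<in> lattice_ideal"
      unfolding eq by (intro ideal2_add ideal2_mult z)
  qed
qed

lemma lookup_symbol:
  assumes "finite {\<alpha>. a \<alpha> \<noteq> 0}"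
  shows "Poly_Mapping.lookup (symbol a) = a"
proof
  fix \<gamma>
  have "Poly_Mapping.lookup (symbol a) \<gamma> = (\<Sum>\<alpha> | a \<alpha> \<noteq> 0. if \<alpha> = \<gamma> then a \<alpha> else 0)"
    unfolding symbol_def lookup_sum lookup_single when_def by simp
  then show "Poly_Mapping.lookup (symbol a) \<gamma> = a \<gamma>"
    using assms by simp
qed

lemma keys_symbol:
  assumes "finite {\<alpha>. a \<alpha> \<noteq> 0}"
  shows "Poly_Mapping.keys (symbol a) = {\<alpha>. a \<alpha> \<noteq> 0}"
  by (auto simp: in_keys_iff lookup_symbol[OF assms])

lemma coset_sum_symbol:
  assumes "\<And>\<eta>. finite {\<alpha>. a \<eta> \<alpha> \<noteq> 0}"
  shows "coset_sum (symbol (a \<eta>)) = subdiv a \<eta> (\<lambda>_. 1)"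
proof
  fix \<alpha>
  let ?S = "{\<beta>. a \<eta> (\<alpha> - W \<eta> *v \<beta>) \<noteq> 0}"
  have "coset_sum (symbol (a \<eta>)) \<alpha> = (\<Sum>\<gamma> | a \<eta> \<gamma> \<noteq> 0. of_bool (\<alpha> - \<gamma> \<in> lattice) * a \<eta> \<gamma>)"
    by (simp add: coset_sum_def keys_symbol assms lookup_symbol)
  also have "\<dots> = (\<Sum>\<gamma>\<in>(\<lambda>\<beta>. \<alpha> - W \<eta> *v \<beta>) ` ?S. a \<eta> \<gamma>)"
  proof (rule sum.mono_neutral_cong_right[OF assms])
    show "\<forall>i\<in>{\<gamma>. a \<eta> \<gamma> \<noteq> 0} - (\<lambda>\<beta>. \<alpha> - W \<eta> *v \<beta>) ` ?S. of_bool (\<alpha> - i \<in> lattice) * a \<eta> i = 0"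
      by (auto simp: lattice_iff[of _ \<eta>] image_iff) (metis add_diff_cancel_left' diff_add_cancel)
  qed (auto simp: lattice_iff[of _ \<eta>])
  also have "\<dots> = (\<Sum>\<beta>\<in>?S. a \<eta> (\<alpha> - W \<eta> *v \<beta>))"
    by (subst sum.reindex) (auto simp: inj_on_def inj_W)
  finally show "coset_sum (symbol (a \<eta>)) \<alpha> = subdiv a \<eta> (\<lambda>_. 1) \<alpha>"
    by (simp add: subdiv_def)
qed

lemma sum_coset_sums: "(\<Sum>\<gamma>\<in>Poly_Mapping.keys p. Poly_Mapping.lookup p \<gamma>) = (\<Sum>\<delta>\<in>residues. coset_sum p \<delta>)"
proof -
  have "(\<Sum>\<delta>\<in>residues. coset_sum p \<delta>) =
      (\<Sum>\<gamma>\<in>Poly_Mapping.keys p. \<Sum>\<delta>\<in>residues. of_bool (\<delta> - \<gamma> \<in> lattice) * Poly_Mapping.lookup p \<gamma>)"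
    unfolding coset_sum_def by (rule sum.swap)
  also have "\<dots> = (\<Sum>\<gamma>\<in>Poly_Mapping.keys p. \<Sum>\<delta>\<in>residues. if residue \<gamma> = \<delta> then Poly_Mapping.lookup p \<gamma> else 0)"
    by (intro sum.cong) (auto simp: residue_eq_iff)
  also have "\<dots> = (\<Sum>\<gamma>\<in>Poly_Mapping.keys p. Poly_Mapping.lookup p \<gamma>)"
    by (simp add: finite_residues residue_in)
  finally show ?thesis by simp
qed

text \<open>
  The values of \<open>S\<^sub>\<eta> 1\<close> are the coset sums of \<open>a\<^sub>\<eta>\<close>. There are 8 of them and they add up to the total mass,
  so if they agree, then they are 1 exactly when the mass is 8.
\<close>

lemma reproduces_const_iff:
  assumes mask: "\<And>\<eta>. finite {\<alpha>. a \<eta> \<alpha> \<noteq> 0}"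
  shows "subdiv a \<eta> (\<lambda>_. 1) = (\<lambda>_. 1) \<longleftrightarrow> (\<Sum>\<alpha> | a \<eta> \<alpha> \<noteq> 0. a \<eta> \<alpha>) = 8 \<and> symbol (a \<eta>) \<in> I"
proof -
  have "(\<Sum>\<alpha> | a \<eta> \<alpha> \<noteq> 0. a \<eta> \<alpha>) = (\<Sum>\<delta>\<in>residues. coset_sum (symbol (a \<eta>)) \<delta>)"
    using sum_coset_sums[of "symbol (a \<eta>)"] by (simp add: keys_symbol mask lookup_symbol)
  moreover have "(\<Sum>\<delta>\<in>residues. coset_sum (symbol (a \<eta>)) \<delta>) = 8 * t"
    if "\<forall>\<alpha>. coset_sum (symbol (a \<eta>)) \<alpha> = t" for t
    using that by (simp add: card_residues)
  ultimately show ?thesis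
    unfolding I_iff coset_sum_symbol[OF mask, symmetric] fun_eq_iff
    by (metis mult.commute mult_cancel_right1 zero_neq_numeral)
qed

lemma representation_mask_coeff:
  assumes a: "finite {\<alpha>. a \<alpha> \<noteq> 0}" and B: "representation_mask \<eta> a B"
  shows "a (\<alpha> - axis j 1) - a \<alpha> =
    (\<Sum>k\<in>UNIV. B (\<alpha> - W \<eta> *v axis k 1) $ j $ k - B \<alpha> $ j $ k)"
proof -
  let ?b = "\<lambda>k. symbol (\<lambda>\<alpha>. B \<alpha> $ j $ k)"
  have fB: "finite {\<alpha>. B \<alpha> $ j $ k \<noteq> 0}" for k
    by (rule finite_subset[of _ "{\<alpha>. B \<alpha> \<noteq> 0}"]) (use B in \<open>auto simp: representation_mask_def\<close>)
  have "(zvar j - 1) * symbol a = (\<Sum>k\<in>UNIV. ?b k * (zpow (column k (W \<eta>)) - 1))"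
    using B unfolding representation_mask_def vec_eq_iff matrix_vector_mult_def matrix_symbol_def
    by simp
  then have "zpow (axis j 1) * symbol a - symbol a = (\<Sum>k\<in>UNIV. zpow (W \<eta> *v axis k 1) * ?b k - ?b k)"
    by (simp only: zvar_def W_mult_axis left_diff_distrib right_diff_distrib
        mult_1_left mult_1_right mult.commute[of "zpow (column _ _)"])
  then have "Poly_Mapping.lookup (zpow (axis j 1) * symbol a - symbol a) \<alpha> =
     Poly_Mapping.lookup (\<Sum>k\<in>UNIV. zpow (W \<eta> *v axis k 1) * ?b k - ?b k) \<alpha>" by simp
  then show ?thesis
    by (simp add: lookup_minus lookup_sum lookup_zpow_mult lookup_symbol[OF a] lookup_symbol[OF fB])
qed

text \<open>
  The defining identity of a representation mask, compared coefficientwise, writes a difference of the mask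
  as differences of \<open>B\<close> along the columns of \<open>W\<^sub>\<eta>\<close>. Summation by parts moves these onto \<open>c\<close>: a shift of
  \<open>\<alpha>\<close> by a column of \<open>W\<^sub>\<eta>\<close> is a unit shift of \<open>\<beta>\<close>.
\<close>

lemma nabla_subdiv:
  assumes mask: "\<And>\<eta>. finite {\<alpha>. a \<eta> \<alpha> \<noteq> 0}" and B: "representation_mask \<eta> (a \<eta>) (B \<eta>)"
  shows "nabla (subdiv a \<eta> c) = vsubdiv B \<eta> (nabla c)"
proof -
  have "nabla (subdiv a \<eta> c) \<alpha> $ j = vsubdiv B \<eta> (nabla c) \<alpha> $ j" for \<alpha> j
  proof -
    let ?G = "{\<beta>. B \<eta> (\<alpha> - W \<eta> *v \<beta>) \<noteq> 0}"
    \<comment> \<open>A finite index set containing the support of every sum below.\<close>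
    define F where "F = ?G \<union> (\<Union>k. (\<lambda>\<beta>. \<beta> - axis k 1) ` ?G) \<union>
      {\<beta>. a \<eta> (\<alpha> - W \<eta> *v \<beta>) \<noteq> 0} \<union> {\<beta>. a \<eta> (\<alpha> - axis j 1 - W \<eta> *v \<beta>) \<noteq> 0}"
    have G: "finite ?G"
      using finite_W_preimage[of "{\<alpha>. B \<eta> \<alpha> \<noteq> 0}" \<alpha> \<eta>] B by (simp add: representation_mask_def)
    then have F: "finite F"
      using finite_stencil[of a, OF mask] by (simp add: F_def)
    have neighbour: "(\<Sum>\<beta>\<in>F. B \<eta> (\<alpha> - W \<eta> *v \<beta> - W \<eta> *v axis k 1) $ j $ k * c \<beta>) =
        (\<Sum>\<beta>\<in>?G. B \<eta> (\<alpha> - W \<eta> *v \<beta>) $ j $ k * c (\<beta> - axis k 1))" for k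
    proof -
      have W_neighbour: "\<alpha> - W \<eta> *v \<beta> - W \<eta> *v axis k 1 = \<alpha> - W \<eta> *v (\<beta> + axis k 1)" for \<beta>
        by (simp add: matrix_vector_right_distrib algebra_simps)
      have "(\<Sum>\<beta>\<in>F. B \<eta> (\<alpha> - W \<eta> *v \<beta> - W \<eta> *v axis k 1) $ j $ k * c \<beta>) =
          (\<Sum>\<beta>\<in>(\<lambda>\<beta>. \<beta> - axis k 1) ` ?G. B \<eta> (\<alpha> - W \<eta> *v (\<beta> + axis k 1)) $ j $ k * c \<beta>)"
        unfolding W_neighbour using F
      proof (intro sum.mono_neutral_right ballI)
        fix \<beta> assume "\<beta> \<in> F - (\<lambda>\<beta>. \<beta> - axis k 1) ` ?G"
        moreover have "\<beta> \<in> (\<lambda>\<beta>. \<beta> - axis k 1) ` ?G" if "\<beta> + axis k 1 \<in> ?G"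
          using imageI[OF that, of "\<lambda>\<beta>. \<beta> - axis k 1"] by simp
        ultimately have "\<beta> + axis k 1 \<notin> ?G" by blast
        then show "B \<eta> (\<alpha> - W \<eta> *v (\<beta> + axis k 1)) $ j $ k * c \<beta> = 0" by simp
      next
        show "(\<lambda>\<beta>. \<beta> - axis k 1) ` ?G \<subseteq> F"
          unfolding F_def by (intro le_supI1 le_supI2 UN_upper) simp
      qed
      then show ?thesis
        by (simp add: sum.reindex)
    qed
    have same: "(\<Sum>\<beta>\<in>F. B \<eta> (\<alpha> - W \<eta> *v \<beta>) $ j $ k * c \<beta>) =
        (\<Sum>\<beta>\<in>?G. B \<eta> (\<alpha> - W \<eta> *v \<beta>) $ j $ k * c \<beta>)" for k
      using F by (intro sum.mono_neutral_right) (auto simp: F_def)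
    have "nabla (subdiv a \<eta> c) \<alpha> $ j =
        (\<Sum>\<beta>\<in>F. (a \<eta> (\<alpha> - W \<eta> *v \<beta> - axis j 1) - a \<eta> (\<alpha> - W \<eta> *v \<beta>)) * c \<beta>)"
      using subdiv_eq[of a F \<eta> "\<alpha> - axis j 1" c, OF mask F] subdiv_eq[of a F \<eta> \<alpha> c, OF mask F]
      by (simp add: nabla_def F_def sum_subtractf left_diff_distrib algebra_simps)
    also have "\<dots> = (\<Sum>k\<in>UNIV. (\<Sum>\<beta>\<in>F. B \<eta> (\<alpha> - W \<eta> *v \<beta> - W \<eta> *v axis k 1) $ j $ k * c \<beta>) -
        (\<Sum>\<beta>\<in>F. B \<eta> (\<alpha> - W \<eta> *v \<beta>) $ j $ k * c \<beta>))"
      by (simp add: representation_mask_coeff[OF mask B] sum_distrib_right left_diff_distrib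
          sum.swap[of _ F] flip: sum_subtractf)
    also have "\<dots> = (\<Sum>k\<in>UNIV. \<Sum>\<beta>\<in>?G. B \<eta> (\<alpha> - W \<eta> *v \<beta>) $ j $ k * nabla c \<beta> $ k)"
      by (simp add: neighbour same nabla_def right_diff_distrib flip: sum_subtractf)
    also have "\<dots> = vsubdiv B \<eta> (nabla c) \<alpha> $ j"
      by (subst sum.swap) (simp add: vsubdiv_def matrix_vector_mult_def)
    finally show ?thesis .
  qed
  then show ?thesis by (simp add: fun_eq_iff vec_eq_iff)
qed

lemma nabla_subdiv_word:
  assumes "\<And>\<eta>. finite {\<alpha>. a \<eta> \<alpha> \<noteq> 0}" "\<And>\<eta>. representation_mask \<eta> (a \<eta>) (B \<eta>)"
  shows "vsubdiv_word B w (nabla c) = nabla (subdiv_word a w c)"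
  by (induction w arbitrary: c)
     (simp_all add: vsubdiv_word_def subdiv_word_def flip: nabla_subdiv[where a = a and B = B, OF assms])

section \<open>Sup norms of differences and growth along words\<close>

lemma step_bound_mono: "step_bound c m \<Longrightarrow> m \<le> m' \<Longrightarrow> step_bound c m'"
  unfolding step_bound_def by (meson order_trans)

lemma step_bound_iff_nabla: "step_bound c m \<longleftrightarrow> (\<forall>\<alpha>. infnorm (nabla c \<alpha>) \<le> m)"
  by (simp add: step_bound_def infnorm_2 nabla_def forall_2)

lemma supnorm_nabla_le: "step_bound c m \<Longrightarrow> supnorm (nabla c) \<le> m"
  by (auto simp: supnorm_def step_bound_iff_nabla intro!: cSUP_least)

lemma bdd_above_nabla: "step_bound c m \<Longrightarrow> bdd_above (range (\<lambda>\<alpha>. infnorm (nabla c \<alpha>)))"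
  by (auto simp: step_bound_iff_nabla)

lemma step_bound_supnorm: "step_bound c m \<Longrightarrow> step_bound c (supnorm (nabla c))"
  unfolding supnorm_def
  by (subst step_bound_iff_nabla) (auto intro!: cSUP_upper bdd_above_nabla)

lemma supnorm_nabla_nonneg: "step_bound c m \<Longrightarrow> 0 \<le> supnorm (nabla c)"
  using step_bound_supnorm step_bound_nonneg by blast

lemma step_bound_bounded:
  assumes "\<And>\<alpha>. \<bar>c \<alpha>\<bar> \<le> K"
  shows "step_bound c (2 * K)"
  unfolding step_bound_def
proof (intro allI)
  fix \<alpha> j
  show "\<bar>c (\<alpha> - axis j 1) - c \<alpha>\<bar> \<le> 2 * K"
    using assms[of \<alpha>] assms[of "\<alpha> - axis j 1"] by linarith
qed

lemma step_bound_delta: "step_bound delta 1"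
  by (simp add: step_bound_def delta_def)

definition mask_norm :: "(bit \<Rightarrow> int^2 \<Rightarrow> real) \<Rightarrow> bit \<Rightarrow> real" where
  "mask_norm a \<eta> = (\<Sum>\<gamma> | a \<eta> \<gamma> \<noteq> 0. \<bar>a \<eta> \<gamma>\<bar>)"

lemma mask_norm_nonneg: "0 \<le> mask_norm a \<eta>"
  by (simp add: mask_norm_def sum_nonneg)

text \<open>
  If the data near \<open>W\<^sub>\<eta>\<^sup>-\<^sup>1 \<alpha>\<close> are close to \<open>t\<close>, then one subdivision step yields nearly \<open>t\<close> times a coset
  sum. Both directions of the theorem rest on this estimate.
\<close>

lemma abs_subdiv_diff_le:
  assumes mask: "\<And>\<eta>. finite {\<alpha>. a \<eta> \<alpha> \<noteq> 0}"
    and c: "\<And>\<beta>. a \<eta> (\<alpha> - W \<eta> *v \<beta>) \<noteq> 0 \<Longrightarrow> \<bar>c \<beta> - t\<bar> \<le> m" and "0 \<le> m"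
  shows "\<bar>subdiv a \<eta> c \<alpha> - t * subdiv a \<eta> (\<lambda>_. 1) \<alpha>\<bar> \<le> mask_norm a \<eta> * m"
proof -
  let ?S = "{\<beta>. a \<eta> (\<alpha> - W \<eta> *v \<beta>) \<noteq> 0}"
  have "subdiv a \<eta> c \<alpha> - t * subdiv a \<eta> (\<lambda>_. 1) \<alpha> = (\<Sum>\<beta>\<in>?S. a \<eta> (\<alpha> - W \<eta> *v \<beta>) * (c \<beta> - t))"
    by (simp add: subdiv_def sum_distrib_left algebra_simps flip: sum_subtractf)
  also have "\<bar>\<dots>\<bar> \<le> (\<Sum>\<beta>\<in>?S. \<bar>a \<eta> (\<alpha> - W \<eta> *v \<beta>)\<bar> * m)"
    using c by (intro order_trans[OF sum_abs] sum_mono) (auto simp: abs_mult intro!: mult_left_mono)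
  also have "\<dots> = (\<Sum>\<gamma>\<in>(\<lambda>\<beta>. \<alpha> - W \<eta> *v \<beta>) ` ?S. \<bar>a \<eta> \<gamma>\<bar>) * m"
    by (subst sum.reindex) (auto simp: inj_on_def inj_W sum_distrib_right)
  also have "\<dots> \<le> mask_norm a \<eta> * m"
    unfolding mask_norm_def using mask \<open>0 \<le> m\<close>
    by (intro mult_right_mono sum_mono2) auto
  finally show ?thesis .
qed

lemma abs_mask_le:
  assumes "\<And>\<eta>. finite {\<alpha>. a \<eta> \<alpha> \<noteq> 0}"
  shows "\<bar>a \<eta> \<alpha>\<bar> \<le> mask_norm a \<eta>"
proof (cases "a \<eta> \<alpha> = 0")
  case False
  then show ?thesis
    unfolding mask_norm_def using assms by (intro member_le_sum) auto
qed (simp add: mask_norm_nonneg)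

text \<open>
  A crude exponential bound. It ensures that suprema of differences are finite, and it covers the words
  that are too short to be cut into contracting blocks.
\<close>

lemma step_bound_growth:
  assumes mask: "\<And>\<eta>. finite {\<alpha>. a \<eta> \<alpha> \<noteq> 0}" and const: "\<And>\<eta>. subdiv a \<eta> (\<lambda>_. 1) = (\<lambda>_. 1)"
  obtains M where "M \<ge> 1"
    "\<And>w c m. step_bound c m \<Longrightarrow> step_bound (subdiv_word a w c) (M ^ length w * m)"
proof -
  obtain C where C: "C \<ge> 0" "\<And>w c m q. step_bound c m \<Longrightarrow> step_bound (subdiv_word a w delta) q \<Longrightarrow>
        step_bound (subdiv_word a w c) (C * q * m)"
    using step_bound_subdiv_word[of a, OF mask const] by blast
  define q where "q = 2 * (mask_norm a 0 + mask_norm a 1)"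
  have q: "0 \<le> q" by (simp add: q_def mask_norm_nonneg)
  have delta: "step_bound (subdiv_word a [\<eta>] delta) q" for \<eta>
  proof -
    have "mask_norm a \<eta> \<le> mask_norm a 0 + mask_norm a 1"
      using mask_norm_nonneg[of a] by (cases \<eta>) auto
    then show ?thesis
      using step_bound_bounded[of "a \<eta>", OF abs_mask_le[of a, OF mask]]
      by (auto simp: q_def subdiv_word_simps subdiv_delta[of a, OF mask] elim!: step_bound_mono)
  qed
  define M where "M = max 1 (C * q)"
  have letter: "step_bound (subdiv a \<eta> c) (M * m)" if "step_bound c m" for \<eta> c m
  proof -
    have "step_bound (subdiv_word a [\<eta>] c) (C * q * m)"
      by (rule C(2)[OF that delta])
    moreover have "C * q * m \<le> M * m"
      using step_bound_nonneg[OF that] by (intro mult_right_mono) (auto simp: M_def)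
    ultimately show ?thesis
      by (auto simp: subdiv_word_simps elim: step_bound_mono)
  qed
  have "step_bound (subdiv_word a w c) (M ^ length w * m)" if "step_bound c m" for w c m
    using that
  proof (induction w arbitrary: c m)
    case (Cons \<eta> w)
    have "step_bound (subdiv_word a w (subdiv a \<eta> c)) (M ^ length w * (M * m))"
      by (intro Cons.IH letter Cons.prems)
    then show ?case by (simp add: subdiv_word_simps mult_ac)
  qed (simp add: subdiv_word_simps)
  moreover have "1 \<le> M" by (simp add: M_def)
  ultimately show ?thesis using that by blast
qed

section \<open>The restricted joint spectral radius in terms of scalar steps\<close>

lemma root_le_of_le_power:
  assumes "0 < n" "0 \<le> s" "root n s \<le> r"
  shows "s \<le> r ^ n"
proof -
  have "s = root n s ^ n" using assms by simp
  also have "\<dots> \<le> r ^ n" using assms by (intro power_mono) auto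
  finally show ?thesis .
qed

text \<open>
  The supremum in the spectral radius runs over a set of vectors that contains \<open>\<nabla>\<delta>\<close>.
\<close>

lemma jsr_less_oneD:
  assumes mask: "\<And>\<eta>. finite {\<alpha>. a \<eta> \<alpha> \<noteq> 0}" and const: "\<And>\<eta>. subdiv a \<eta> (\<lambda>_. 1) = (\<lambda>_. 1)"
    and B: "\<And>\<eta>. representation_mask \<eta> (a \<eta>) (B \<eta>)" and jsr: "restricted_jsr B < 1"
  obtains r N where "0 < r" "r < 1"
    "\<And>w. N \<le> length w \<Longrightarrow> step_bound (subdiv_word a w delta) (r ^ length w)"
proof -
  define g where "g = (\<lambda>n. SUP \<epsilon> \<in> {\<epsilon>. length \<epsilon> = n}.
      SUP v \<in> {nabla c | c. bounded (range c) \<and> supnorm (nabla c) \<le> 1}.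
       ereal (root n (supnorm (vsubdiv_word B \<epsilon> v))))"
  have "limsup g < 1" using jsr by (simp add: restricted_jsr_def g_def)
  then obtain r\<^sub>0 where r\<^sub>0: "limsup g < ereal r\<^sub>0" "ereal r\<^sub>0 < 1"
    using ereal_dense2 by blast
  \<comment> \<open>The value taken from the limit superior need not be positive.\<close>
  define r where "r = max r\<^sub>0 (1 / 2)"
  have "limsup g < ereal r" by (rule less_le_trans[OF r\<^sub>0(1)]) (simp add: r_def)
  then have "eventually (\<lambda>n. g n < ereal r) sequentially" by (rule Limsup_lessD)
  then obtain N where N: "\<And>n. n \<ge> N \<Longrightarrow> g n < ereal r"
    by (auto simp: eventually_sequentially)
  have "step_bound (subdiv_word a w delta) (r ^ length w)" if "Suc N \<le> length w" for w
  proof -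
    let ?s = "supnorm (nabla (subdiv_word a w delta))"
    obtain m where m: "step_bound (subdiv_word a w delta) m"
      using step_bound_growth[of a, OF mask const] step_bound_delta by metis
    have "bounded (range delta)"
      by (rule finite_imp_bounded, rule finite_subset[of _ "{0, 1}"]) (auto simp: delta_def)
    then have "nabla delta \<in> {nabla c | c. bounded (range c) \<and> supnorm (nabla c) \<le> 1}"
      using supnorm_nabla_le[OF step_bound_delta] by blast
    then have "ereal (root (length w) ?s) \<le> g (length w)"
      unfolding g_def nabla_subdiv_word[of a, OF mask B, symmetric]
      by (intro SUP_upper2[where i = w] SUP_upper) auto
    also have "\<dots> < ereal r" using N that by simp
    finally have "root (length w) ?s \<le> r" by simp
    then have "?s \<le> r ^ length w"
      using that supnorm_nabla_nonneg[OF m] by (intro root_le_of_le_power) auto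
    then show ?thesis using step_bound_supnorm[OF m] step_bound_mono by blast
  qed
  moreover have "0 < r" "r < 1" using r\<^sub>0(2) by (auto simp: r_def less_max_iff_disj)
  ultimately show ?thesis using that by blast
qed

text \<open>
  The constant in front of the geometric decay disappears in the limit of the \<open>n\<close>-th roots.
\<close>

lemma jsr_less_oneI:
  assumes mask: "\<And>\<eta>. finite {\<alpha>. a \<eta> \<alpha> \<noteq> 0}" and B: "\<And>\<eta>. representation_mask \<eta> (a \<eta>) (B \<eta>)"
    and \<theta>: "0 < \<theta>" "\<theta> < 1" and M: "0 < M"
    and decay: "\<And>w c m. step_bound c m \<Longrightarrow> step_bound (subdiv_word a w c) (M * \<theta> ^ length w * m)"
  shows "restricted_jsr B < 1"
proof -
  have "restricted_jsr B \<le> limsup (\<lambda>n. ereal (root n M * \<theta>))"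
    unfolding restricted_jsr_def
  proof (rule Limsup_mono, rule eventually_sequentiallyI[of 1], intro SUP_least)
    fix n \<epsilon> v
    assume n: "1 \<le> n" and \<epsilon>: "\<epsilon> \<in> {\<epsilon> :: bit list. length \<epsilon> = n}"
      and "v \<in> {nabla c | c. bounded (range c) \<and> supnorm (nabla c) \<le> 1}"
    then obtain c where c: "v = nabla c" "bounded (range c)" "supnorm (nabla c) \<le> 1" by blast
    then obtain K where "\<And>\<alpha>. \<bar>c \<alpha>\<bar> \<le> K" unfolding bounded_iff by auto
    then have "step_bound c (supnorm (nabla c))"
      using step_bound_supnorm step_bound_bounded by blast
    then have "step_bound c 1" using c(3) step_bound_mono by blast
    from decay[OF this, of \<epsilon>] have "supnorm (vsubdiv_word B \<epsilon> v) \<le> M * \<theta> ^ n"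
      using supnorm_nabla_le \<epsilon> by (auto simp: c(1) nabla_subdiv_word[of a, OF mask B])
    then have "root n (supnorm (vsubdiv_word B \<epsilon> v)) \<le> root n (M * \<theta> ^ n)"
      using n by simp
    also have "\<dots> = root n M * \<theta>"
      using n \<theta> by (simp add: real_root_mult real_root_power_cancel)
    finally show "ereal (root n (supnorm (vsubdiv_word B \<epsilon> v))) \<le> ereal (root n M * \<theta>)" by simp
  qed
  also have "limsup (\<lambda>n. ereal (root n M * \<theta>)) = ereal (1 * \<theta>)"
    by (intro lim_imp_Limsup tendsto_ereal tendsto_mult LIMSEQ_root_const M) auto
  also have "\<dots> < 1" using \<theta> by simp
  finally show ?thesis .
qed

section \<open>Uniform decay from decay along every sequence\<close>

lemma P_0 [simp]: "P 0 \<epsilon> = []"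
  by (simp add: P_def)

lemma P_Suc: "P (Suc n) \<epsilon> = P n \<epsilon> @ [\<epsilon> (Suc n)]"
  by (simp add: P_def)

lemma length_P [simp]: "length (P n \<epsilon>) = n"
  by (simp add: P_def)

text \<open>
  Compactness of \<open>{0,1}\<^sup>\<nat>\<close>, in the form of Koenig's lemma: call a word long if it has extensions that
  avoid \<open>Q\<close> with their prefixes up to any prescribed length. If no uniform bound existed, the empty
  word would be long; a long word has a long extension by one letter, and iterating gives an infinite
  sequence without a prefix in \<open>Q\<close>.
\<close>

lemma uniform_prefix_bound:
  assumes bar: "\<And>\<epsilon> :: nat \<Rightarrow> bit. \<exists>n. Q (P n \<epsilon>)"
  shows "\<exists>N. \<forall>w. N \<le> length w \<longrightarrow> (\<exists>n\<le>N. Q (take n w))"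
proof (rule ccontr)
  define long where "long u \<longleftrightarrow> (\<forall>N\<ge>length u. \<exists>v. N \<le> length (u @ v) \<and> (\<forall>n\<le>N. \<not> Q (take n (u @ v))))" for u
  assume "\<nexists>N. \<forall>w. N \<le> length w \<longrightarrow> (\<exists>n\<le>N. Q (take n w))"
  then have nil: "long []" unfolding long_def by fastforce
  have step: "\<exists>b. long (u @ [b])" if "long u" for u
  proof (rule ccontr)
    assume "\<nexists>b. long (u @ [b])"
    then have "\<forall>b. \<exists>N\<ge>Suc (length u). \<forall>v. N \<le> length (u @ b # v) \<longrightarrow> (\<exists>n\<le>N. Q (take n (u @ b # v)))"
      unfolding long_def by fastforce
    then obtain N where N: "\<And>b. Suc (length u) \<le> N b"
      "\<And>b v. N b \<le> length (u @ b # v) \<Longrightarrow> \<exists>n\<le>N b. Q (take n (u @ b # v))"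
      by metis
    \<comment> \<open>Each one-letter extension fails at some length; at the larger of the two lengths both fail.\<close>
    define K where "K = max (N 0) (N 1)"
    have K: "N b \<le> K" for b by (cases b) (auto simp: K_def)
    then have "length u \<le> K" using N(1)[of 0] by (metis Suc_leD order_trans)
    then obtain v where v: "K \<le> length (u @ v)" "\<forall>n\<le>K. \<not> Q (take n (u @ v))"
      using \<open>long u\<close> unfolding long_def by blast
    have "Suc (length u) \<le> length (u @ v)" using N(1)[of 0] K[of 0] v(1) by linarith
    then obtain b v' where "v = b # v'" by (cases v) auto
    then show False using N(2)[of b v'] K[of b] v by (meson order_trans)
  qed
  have "\<exists>U. \<forall>n. (long (U n) \<and> length (U n) = n) \<and> (\<exists>b. U (Suc n) = U n @ [b])"
  proof (rule dependent_nat_choice)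
    show "\<exists>u. long u \<and> length u = 0" using nil by simp
    show "\<exists>u'. (long u' \<and> length u' = Suc n) \<and> (\<exists>b. u' = u @ [b])" if "long u \<and> length u = n" for u n
      using step[of u] that by force
  qed
  then obtain U b where U: "\<And>n. long (U n)" "\<And>n. length (U n) = n" "\<And>n. U (Suc n) = U n @ [b n]"
    by metis
  \<comment> \<open>Sequences are read from index 1 on, whereas the choice of letters starts at 0.\<close>
  have "P n (\<lambda>i. b (i - 1)) = U n" for n
  proof (induction n)
    case 0
    then show ?case using U(2)[of 0] by simp
  qed (simp add: P_Suc U(3))
  then obtain n where "Q (U n)" using bar[of "\<lambda>i. b (i - 1)"] by auto
  then show False using U(1)[of n] unfolding long_def by fastforce
qed

text \<open>
  Steps of \<open>S\<^sub>w \<delta>\<close> below a suitable threshold make \<open>w\<close> halve the steps of every sequence. The halving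
  prefixes have length at most some \<open>N\<close>, so a word of length \<open>n\<close> contains at least \<open>n div N\<close> of them.
\<close>

lemma uniform_decay:
  assumes mask: "\<And>\<eta>. finite {\<alpha>. a \<eta> \<alpha> \<noteq> 0}" and const: "\<And>\<eta>. subdiv a \<eta> (\<lambda>_. 1) = (\<lambda>_. 1)"
    and small: "\<And>(\<epsilon> :: nat \<Rightarrow> bit) q. 0 < q \<Longrightarrow> \<exists>n>0. step_bound (subdiv_word a (P n \<epsilon>) delta) q"
  obtains M \<theta> where "0 < M" "0 < \<theta>" "\<theta> < 1"
    "\<And>w c m. step_bound c m \<Longrightarrow> step_bound (subdiv_word a w c) (M * \<theta> ^ length w * m)"
proof -
  obtain C where C: "C \<ge> 0" "\<And>w c m q. step_bound c m \<Longrightarrow> step_bound (subdiv_word a w delta) q \<Longrightarrow>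
        step_bound (subdiv_word a w c) (C * q * m)"
    using step_bound_subdiv_word[of a, OF mask const] by blast
  obtain G where G: "G \<ge> 1"
    "\<And>w c m. step_bound c m \<Longrightarrow> step_bound (subdiv_word a w c) (G ^ length w * m)"
    using step_bound_growth[of a, OF mask const] by blast
  define halving where "halving w \<longleftrightarrow> (\<forall>c m. step_bound c m \<longrightarrow> step_bound (subdiv_word a w c) (m / 2))" for w
  have "\<exists>n. P n \<epsilon> \<noteq> [] \<and> halving (P n \<epsilon>)" for \<epsilon>
  proof -
    \<comment> \<open>This makes the factor \<open>C q\<close> at most 1/2 also when \<open>C = 0\<close>.\<close>
    define q where "q = 1 / (2 * C + 2)"
    have q: "0 < q" "C * q \<le> 1 / 2" using C(1) by (auto simp: q_def field_simps)
    obtain n where n: "n > 0" "step_bound (subdiv_word a (P n \<epsilon>) delta) q"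
      using small[OF q(1)] by blast
    have "halving (P n \<epsilon>)"
      unfolding halving_def
    proof (intro allI impI)
      fix c m assume c: "step_bound c m"
      have "C * q * m \<le> 1 / 2 * m" by (intro mult_right_mono q step_bound_nonneg[OF c])
      then show "step_bound (subdiv_word a (P n \<epsilon>) c) (m / 2)"
        using C(2)[OF c n(2)] step_bound_mono by fastforce
    qed
    moreover have "P n \<epsilon> \<noteq> []" using n(1) by (cases n) (auto simp: P_Suc)
    ultimately show ?thesis by blast
  qed
  from uniform_prefix_bound[of "\<lambda>w. w \<noteq> [] \<and> halving w", OF this]
  obtain N where N: "\<And>w. N \<le> length w \<Longrightarrow> \<exists>n\<le>N. take n w \<noteq> [] \<and> halving (take n w)" by blast
  have "N > 0" using N[of "[]"] by (cases N) auto
  have block: "step_bound (subdiv_word a w c) (G ^ N * (1 / 2) ^ (length w div N) * m)"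
    if "step_bound c m" for w c m
    using that
  proof (induction "length w" arbitrary: w c m rule: less_induct)
    case less
    note m = step_bound_nonneg[OF less.prems]
    show ?case
    proof (cases "length w < N")
      case True
      then have "G ^ length w * m \<le> G ^ N * (1 / 2) ^ (length w div N) * m"
        using G(1) m by (auto intro!: mult_right_mono power_increasing)
      then show ?thesis using G(2)[OF less.prems, of w] step_bound_mono by blast
    next
      case False
      then obtain n where n: "n \<le> N" "take n w \<noteq> []" "halving (take n w)" using N[of w] by auto
      have "n > 0" "w \<noteq> []" using n(2) by auto
      have "step_bound (subdiv_word a (take n w) c) (m / 2)"
        using n(3) less.prems unfolding halving_def by blast
      moreover have "length (drop n w) < length w" using \<open>n > 0\<close> \<open>w \<noteq> []\<close> by simp
      ultimately have "step_bound (subdiv_word a (drop n w) (subdiv_word a (take n w) c))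
          (G ^ N * (1 / 2) ^ (length (drop n w) div N) * (m / 2))"
        by (intro less.hyps)
      then have *: "step_bound (subdiv_word a w c) (G ^ N * (1 / 2) ^ (length (drop n w) div N) * (m / 2))"
        by (simp flip: subdiv_word_append)
      have "length w div N = Suc ((length w - N) div N)"
        using False \<open>N > 0\<close> by (simp add: le_div_geq)
      also have "\<dots> \<le> Suc (length (drop n w) div N)"
        using n(1) by (simp add: div_le_mono)
      finally have "(1 / 2 :: real) ^ Suc (length (drop n w) div N) \<le> (1 / 2) ^ (length w div N)"
        by (intro power_decreasing) auto
      then have "G ^ N * (1 / 2) ^ Suc (length (drop n w) div N) * m \<le> G ^ N * (1 / 2) ^ (length w div N) * m"
        using m G(1) by (intro mult_right_mono mult_left_mono) auto
      then show ?thesis using step_bound_mono[OF *] by simp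
    qed
  qed
  define \<theta> where "\<theta> = root N (1 / 2)"
  have \<theta>: "0 < \<theta>" "\<theta> < 1" "\<theta> ^ N = 1 / 2"
    using \<open>N > 0\<close> by (simp_all add: \<theta>_def)
  have pow: "(1 / 2) ^ (n div N) \<le> 2 * \<theta> ^ n" for n
  proof -
    have "n \<le> N * Suc (n div N)"
      using dividend_less_times_div[OF \<open>N > 0\<close>, of n] by simp
    then have "\<theta> ^ (N * Suc (n div N)) \<le> \<theta> ^ n"
      using \<theta> by (intro power_decreasing) auto
    then show ?thesis by (simp only: power_mult \<theta>(3)) simp
  qed
  show ?thesis
  proof (rule that[of "2 * G ^ N" \<theta>])
    fix w :: "bit list" and c m assume c: "step_bound c m"
    have "G ^ N * (1 / 2) ^ (length w div N) * m \<le> G ^ N * (2 * \<theta> ^ length w) * m"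
      using G(1) step_bound_nonneg[OF c] by (intro mult_right_mono mult_left_mono pow) auto
    then show "step_bound (subdiv_word a w c) (2 * G ^ N * \<theta> ^ length w * m)"
      using step_bound_mono[OF block[OF c]] by (simp add: mult_ac)
  qed (use G(1) \<theta> in auto)
qed

section \<open>Convergence of the scheme\<close>

text \<open>
  The convergence condition for a single sequence, without extended reals and with the inverse of \<open>W\<^sub>w\<close>
  made explicit.
\<close>

definition converges_along :: "(bit \<Rightarrow> int^2 \<Rightarrow> real) \<Rightarrow> (nat \<Rightarrow> bit) \<Rightarrow> (real^2 \<Rightarrow> real) \<Rightarrow> bool" where
  "converges_along a \<epsilon> f \<longleftrightarrow> (\<forall>e>0. \<forall>\<^sub>F n in sequentially. \<forall>\<alpha>.
     \<bar>f (contract_word (P n \<epsilon>) (emb \<alpha>)) - subdiv_word a (P n \<epsilon>) delta \<alpha>\<bar> \<le> e)"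

lemma SUP_ereal_tendsto_0_iff:
  fixes g :: "nat \<Rightarrow> 'a \<Rightarrow> real"
  assumes "\<And>n x. 0 \<le> g n x"
  shows "(\<lambda>n. SUP x. ereal (g n x)) \<longlonglongrightarrow> 0 \<longleftrightarrow> (\<forall>e>0. \<forall>\<^sub>F n in sequentially. \<forall>x. g n x \<le> e)"
proof
  assume lim: "(\<lambda>n. SUP x. ereal (g n x)) \<longlonglongrightarrow> 0"
  show "\<forall>e>0. \<forall>\<^sub>F n in sequentially. \<forall>x. g n x \<le> e"
  proof (intro allI impI)
    fix e :: real assume "0 < e"
    then have "\<forall>\<^sub>F n in sequentially. (SUP x. ereal (g n x)) < ereal e"
      by (intro order_tendstoD(2)[OF lim]) simp
    then show "\<forall>\<^sub>F n in sequentially. \<forall>x. g n x \<le> e"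
    proof (rule eventually_mono, intro allI)
      fix n x assume "(SUP x. ereal (g n x)) < ereal e"
      then have "ereal (g n x) < ereal e"
        by (rule le_less_trans[OF SUP_upper[OF UNIV_I]])
      then show "g n x \<le> e" by simp
    qed
  qed
next
  assume small: "\<forall>e>0. \<forall>\<^sub>F n in sequentially. \<forall>x. g n x \<le> e"
  show "(\<lambda>n. SUP x. ereal (g n x)) \<longlonglongrightarrow> 0"
  proof (rule order_tendstoI)
    fix y :: ereal assume "y < 0"
    moreover have "0 \<le> (SUP x. ereal (g n x))" for n
      by (rule SUP_upper2[OF UNIV_I]) (simp add: assms)
    ultimately show "\<forall>\<^sub>F n in sequentially. y < (SUP x. ereal (g n x))"
      by (intro always_eventually allI) (rule less_le_trans)
  next
    fix y :: ereal assume "0 < y"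
    then obtain e where e: "0 < ereal e" "ereal e < y"
      using ereal_dense2 by blast
    then have "\<forall>\<^sub>F n in sequentially. \<forall>x. g n x \<le> e" using small by simp
    then show "\<forall>\<^sub>F n in sequentially. (SUP x. ereal (g n x)) < y"
      by (rule eventually_mono) (rule le_less_trans[OF SUP_least e(2)], simp)
  qed
qed

lemma scheme_convergent_iff:
  "scheme_convergent a \<longleftrightarrow>
    (\<forall>\<epsilon>. \<exists>f. uniformly_continuous_on UNIV f \<and> (\<exists>x. f x \<noteq> 0) \<and> converges_along a \<epsilon> f)"
  unfolding scheme_convergent_def converges_along_def matrix_inv_W_word emb_def[symmetric]
  by (subst SUP_ereal_tendsto_0_iff) simp_all

lemma converges_alongD:
  assumes "converges_along a \<epsilon> f" "0 < e"
  shows "\<exists>N. \<forall>n\<ge>N. \<forall>\<alpha>. \<bar>f (contract_word (P n \<epsilon>) (emb \<alpha>)) - subdiv_word a (P n \<epsilon>) delta \<alpha>\<bar> \<le> e"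
  using assms unfolding converges_along_def eventually_sequentially by blast

lemma power_times_le:
  fixes L r :: real
  assumes "0 \<le> r" "r < 1" "0 < e"
  shows "\<exists>N. \<forall>n\<ge>N. L * r ^ n \<le> e"
proof -
  have "(\<lambda>n. L * r ^ n) \<longlonglongrightarrow> 0"
    by (intro tendsto_mult_right_zero LIMSEQ_realpow_zero) (use assms in auto)
  from order_tendstoD(2)[OF this assms(3)] show ?thesis
    unfolding eventually_sequentially by (meson less_imp_le)
qed

lemma power_3_4_le:
  assumes "0 < d"
  shows "\<exists>n\<ge>N. (3 / 4 :: real) ^ n * R \<le> d"
proof -
  obtain M where "\<forall>n\<ge>M. R * (3 / 4 :: real) ^ n \<le> d"
    using power_times_le[of "3 / 4" d R] assms by auto
  then show ?thesis
    by (intro exI[of _ "max M N"]) (simp add: mult.commute)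
qed

lemma norm_le_2_infnorm: "norm (x :: real^2) \<le> 2 * infnorm x"
proof -
  have "norm x \<le> \<bar>x $ 1\<bar> + \<bar>x $ 2\<bar>"
    using norm_le_l1_cart[of x] by (simp add: sum_2)
  then show ?thesis by (auto simp: infnorm_2)
qed

lemma dist_contract_word_le:
  "dist (contract_word w y) x \<le>
     2 * (3 / 4) ^ length w * infnorm (y - map_matrix real_of_int (W_word w) *v x)"
proof -
  let ?y = "map_matrix real_of_int (W_word w) *v x"
  have "dist (contract_word w y) x = norm (contract_word w (y - ?y))"
    by (simp add: dist_norm linear_diff[OF linear_contract_word] contract_word_map_W_word)
  also have "\<dots> \<le> 2 * ((3 / 4) ^ length w * infnorm (y - ?y))"
    by (intro order_trans[OF norm_le_2_infnorm] mult_left_mono infnorm_contract_word) simp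
  finally show ?thesis by simp
qed

lemma subdiv_one_shift: "subdiv a \<eta> (\<lambda>_. 1) (\<alpha> + W \<eta> *v \<gamma>) = subdiv a \<eta> (\<lambda>_. 1) \<alpha>"
  using subdiv_shift[of a \<eta> "\<lambda>_. 1" \<gamma> "\<alpha> + W \<eta> *v \<gamma>"] by simp

text \<open>
  For large \<open>n\<close>, move \<open>\<alpha>\<close> within its coset to a point \<open>\<alpha>'\<close> that the inverse of \<open>W\<^sup>n\<^sup>+\<^sup>1\<close> takes close to
  \<open>x\<close>. The data entering the computation of the value at \<open>\<alpha>'\<close> are then all close to \<open>f x\<close>, and the result
  is close to \<open>f x\<close> as well as to \<open>s f x\<close>, where \<open>s\<close> is the coset sum.
\<close>

lemma convergent_imp_reproduces_const:
  assumes mask: "\<And>\<eta>. finite {\<alpha>. a \<eta> \<alpha> \<noteq> 0}"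
    and f: "uniformly_continuous_on UNIV f" "f x \<noteq> 0" and conv: "converges_along a (\<lambda>_. \<eta>) f"
  shows "subdiv a \<eta> (\<lambda>_. 1) = (\<lambda>_. 1)"
proof
  fix \<alpha>
  define s where "s = subdiv a \<eta> (\<lambda>_. 1) \<alpha>"
  define A where "A = mask_norm a \<eta>"
  have A: "0 \<le> A" by (simp add: A_def mask_norm_nonneg)
  have approx: "\<bar>f x - s * f x\<bar> \<le> (2 + A * 2) * e" if "0 < e" for e
  proof -
    from f(1) \<open>0 < e\<close> obtain d where d: "0 < d" "\<And>y. dist y x < d \<Longrightarrow> dist (f y) (f x) < e"
      unfolding uniformly_continuous_on_def by blast
    define R where "R = 2 * (radius a + infnorm (contract \<eta> (emb \<alpha>)) + 1)"
    obtain N where N: "\<And>n \<alpha>. N \<le> n \<Longrightarrow>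
        \<bar>f (contract_word (P n (\<lambda>_. \<eta>)) (emb \<alpha>)) - subdiv_word a (P n (\<lambda>_. \<eta>)) delta \<alpha>\<bar> \<le> e"
      using converges_alongD[OF conv \<open>0 < e\<close>] by blast
    obtain n where n: "N \<le> n" "(3 / 4) ^ n * R \<le> d / 2"
      using power_3_4_le[of "d / 2" N R] d(1) by auto
    define w where "w = P n (\<lambda>_. \<eta>)"
    define c where "c = subdiv_word a w delta"
    define y where "y = map_matrix real_of_int (W_word w) *v x"
    define \<gamma> where "\<gamma> = vfloor y"
    define \<alpha>' where "\<alpha>' = \<alpha> + W \<eta> *v \<gamma>"
    have near: "\<bar>f (contract_word w z) - f x\<bar> \<le> e" if "infnorm (z - y) \<le> R / 2" for z
    proof -
      have "dist (contract_word w z) x \<le> 2 * (3 / 4) ^ length w * (R / 2)"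
        using dist_contract_word_le[of w z x] that
        by (elim order_trans) (auto simp: y_def intro!: mult_left_mono)
      then have "dist (contract_word w z) x < d"
        using n(2) d(1) by (simp add: w_def)
      then show ?thesis using d(2) by (fastforce simp: dist_real_def)
    qed
    have \<alpha>': "contract \<eta> (emb \<alpha>') - y = contract \<eta> (emb \<alpha>) + - (y - emb \<gamma>)"
      by (simp add: \<alpha>'_def emb_arith linear_add[OF linear_contract] contract_W)
    have 1: "infnorm (contract \<eta> (emb \<alpha>') - y) \<le> infnorm (contract \<eta> (emb \<alpha>)) + 1"
      unfolding \<alpha>' by (intro order_trans[OF infnorm_triangle] add_left_mono)
        (simp only: infnorm_neg \<gamma>_def infnorm_vfloor)
    have c: "\<bar>c \<beta> - f x\<bar> \<le> 2 * e" if "a \<eta> (\<alpha>' - W \<eta> *v \<beta>) \<noteq> 0" for \<beta>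
    proof -
      have "infnorm (emb \<beta> - contract \<eta> (emb \<alpha>') + (contract \<eta> (emb \<alpha>') - y)) \<le>
          radius a + (infnorm (contract \<eta> (emb \<alpha>)) + 1)"
        using stencil_radius[of a, OF mask that] 1
        by (intro order_trans[OF infnorm_triangle] add_mono) auto
      then have "\<bar>f (contract_word w (emb \<beta>)) - f x\<bar> \<le> e"
        by (intro near) (simp add: R_def)
      then show ?thesis using N[OF n(1), of \<beta>] unfolding c_def w_def by linarith
    qed
    have "\<bar>subdiv a \<eta> c \<alpha>' - f x * subdiv a \<eta> (\<lambda>_. 1) \<alpha>'\<bar> \<le> A * (2 * e)"
      unfolding A_def using c \<open>0 < e\<close> by (intro abs_subdiv_diff_le[of a, OF mask]) auto
    moreover have "subdiv a \<eta> (\<lambda>_. 1) \<alpha>' = s"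
      unfolding \<alpha>'_def s_def by (rule subdiv_one_shift)
    moreover have "subdiv a \<eta> c \<alpha>' = subdiv_word a (P (Suc n) (\<lambda>_. \<eta>)) delta \<alpha>'"
      by (simp add: P_Suc subdiv_word_append subdiv_word_simps c_def w_def)
    moreover have "\<bar>f (contract_word (P (Suc n) (\<lambda>_. \<eta>)) (emb \<alpha>')) - f x\<bar> \<le> e"
      unfolding P_Suc contract_word_append contract_word_simps w_def[symmetric]
      by (rule near) (use 1 radius_nonneg[of a] in \<open>simp add: R_def\<close>)
    ultimately have "\<bar>f x - s * f x\<bar> \<le> A * (2 * e) + 2 * e"
      using N[of "Suc n" \<alpha>'] n(1) by (simp add: mult.commute[of s])
    then show ?thesis by (simp add: algebra_simps)
  qed
  have "\<bar>f x - s * f x\<bar> \<le> 0"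
  proof (rule field_le_epsilon)
    fix e :: real assume "0 < e"
    then have "\<bar>f x - s * f x\<bar> \<le> (2 + A * 2) * (e / (2 + A * 2))"
      using A by (intro approx) auto
    then show "\<bar>f x - s * f x\<bar> \<le> 0 + e" using A by simp
  qed
  then show "subdiv a \<eta> (\<lambda>_. 1) \<alpha> = 1" using f(2) by (simp add: s_def)
qed

text \<open>
  Neighbouring lattice points are mapped to points at distance at most \<open>2 (3/4)\<^sup>n\<close>, where the uniformly
  continuous limit takes nearly equal values.
\<close>

lemma convergent_imp_small_steps:
  assumes f: "uniformly_continuous_on UNIV f" and conv: "converges_along a \<epsilon> f" and "0 < q"
  shows "\<exists>n>0. step_bound (subdiv_word a (P n \<epsilon>) delta) q"
proof -
  from f \<open>0 < q\<close> obtain d where d: "0 < d" "\<And>x y. dist x y < d \<Longrightarrow> dist (f x) (f y) < q / 3"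
    unfolding uniformly_continuous_on_def by (metis UNIV_I divide_pos_pos zero_less_numeral)
  obtain N where N: "\<And>n \<alpha>. N \<le> n \<Longrightarrow>
      \<bar>f (contract_word (P n \<epsilon>) (emb \<alpha>)) - subdiv_word a (P n \<epsilon>) delta \<alpha>\<bar> \<le> q / 3"
    using converges_alongD[OF conv, of "q / 3"] \<open>0 < q\<close> by auto
  obtain n where n: "Suc N \<le> n" "(3 / 4) ^ n * 2 \<le> d / 2"
    using power_3_4_le[of "d / 2" "Suc N" 2] d(1) by auto
  have "\<bar>subdiv_word a (P n \<epsilon>) delta (\<alpha> - axis j 1) - subdiv_word a (P n \<epsilon>) delta \<alpha>\<bar> \<le> q" for \<alpha> j
  proof -
    let ?z = "emb (\<alpha> - axis j 1) - emb \<alpha>"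
    have "infnorm ?z \<le> 1" by (simp add: infnorm_2 axis_def)
    then have "norm (contract_word (P n \<epsilon>) ?z) \<le> 2 * ((3 / 4) ^ n * 1)"
      by (intro order_trans[OF norm_le_2_infnorm] order_trans[OF mult_left_mono[OF infnorm_contract_word]])
         (auto intro!: mult_left_mono)
    then have "norm (contract_word (P n \<epsilon>) ?z) < d" using n(2) d(1) by simp
    then have "dist (f (contract_word (P n \<epsilon>) (emb (\<alpha> - axis j 1))))
        (f (contract_word (P n \<epsilon>) (emb \<alpha>))) < q / 3"
      by (intro d(2)) (simp add: dist_norm linear_diff[OF linear_contract_word])
    then show ?thesis
      using N[of n \<alpha>] N[of n "\<alpha> - axis j 1"] n(1) unfolding dist_real_def by linarith
  qed
  then show ?thesis using n(1) by (intro exI[of _ n]) (auto simp: step_bound_def)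
qed

lemma geometric_increments_limit:
  fixes g :: "nat \<Rightarrow> real"
  assumes r: "0 < r" "r < 1" and g: "\<And>n. n \<ge> N \<Longrightarrow> \<bar>g (Suc n) - g n\<bar> \<le> K * r ^ n"
  shows "\<exists>l. \<forall>n\<ge>N. \<bar>l - g n\<bar> \<le> K * r ^ n / (1 - r)"
proof -
  define h where "h k = g (Suc k) - g k" for k
  have sum_K: "(\<lambda>k. K * r ^ (k + n)) sums (K * r ^ n / (1 - r))" for n
    using sums_mult[OF geometric_sums[of r], of "K * r ^ n"] r by (simp add: power_add mult_ac)
  have h: "summable h"
    by (rule summable_comparison_test'[of "\<lambda>k. K * r ^ (k + 0)" N])
       (use g sums_summable[OF sum_K] in \<open>auto simp: h_def\<close>)
  have "\<bar>(g 0 + suminf h) - g n\<bar> \<le> K * r ^ n / (1 - r)" if "n \<ge> N" for n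
  proof -
    have "(g 0 + suminf h) - g n = suminf (\<lambda>k. h (k + n))"
      using suminf_minus_initial_segment[OF h, of n] sum_lessThan_telescope[of g n]
      by (simp add: h_def[abs_def])
    also have "norm \<dots> \<le> suminf (\<lambda>k. K * r ^ (k + n))"
      by (rule norm_suminf_le) (use g that sums_summable[OF sum_K] in \<open>auto simp: h_def\<close>)
    also have "\<dots> = K * r ^ n / (1 - r)" using sums_unique[OF sum_K] by simp
    finally show ?thesis by simp
  qed
  then show ?thesis by blast
qed

text \<open>
  The approximants are the step functions \<open>F\<^sub>n x = c\<^sub>n \<lfloor>W\<^sub>w x\<rfloor>\<close> with \<open>c\<^sub>n = S\<^sub>w \<delta>\<close>. They take the value
  \<open>c\<^sub>n \<alpha>\<close> at \<open>W\<^sub>w\<^sup>-\<^sup>1 \<alpha>\<close>, so uniform convergence of the \<open>F\<^sub>n\<close> is the convergence required of the scheme.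
\<close>

lemma decay_imp_convergent:
  assumes mask: "\<And>\<eta>. finite {\<alpha>. a \<eta> \<alpha> \<noteq> 0}" and const: "\<And>\<eta>. subdiv a \<eta> (\<lambda>_. 1) = (\<lambda>_. 1)"
    and r: "0 < r" "r < 1"
    and decay: "\<And>w. N \<le> length w \<Longrightarrow> step_bound (subdiv_word a w delta) (r ^ length w)"
  shows "\<exists>f. uniformly_continuous_on UNIV f \<and> (\<exists>x. f x \<noteq> 0) \<and> converges_along a \<epsilon> f"
proof -
  define w where "w n = P n \<epsilon>" for n
  define c where "c n = subdiv_word a (w n) delta" for n
  define R where "R n x = map_matrix real_of_int (W_word (w n)) *v x" for n x
  define F where "F n x = c n (vfloor (R n x))" for n x
  define A where "A = mask_norm a 0 + mask_norm a 1"
  define K where "K = A * (2 * (radius a + 2))"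
  have A: "mask_norm a \<eta> \<le> A" for \<eta>
    using mask_norm_nonneg[of a] by (cases \<eta>) (auto simp: A_def)
  have c: "step_bound (c n) (r ^ n)" if "N \<le> n" for n
    using decay[of "w n"] that by (simp add: c_def w_def)
  have contract_R: "contract \<eta> (R (Suc n) x) = R n x" if "\<eta> = \<epsilon> (Suc n)" for n x \<eta>
  proof -
    have "contract_word (w n) (contract \<eta> (R (Suc n) x)) = contract_word (w (Suc n)) (R (Suc n) x)"
      by (simp add: w_def P_Suc contract_word_append that)
    also have "\<dots> = x" by (simp add: R_def contract_word_map_W_word)
    finally show ?thesis by (metis R_def map_W_word_contract_word)
  qed
  have "\<bar>F (Suc n) x - F n x\<bar> \<le> K * r ^ n" if "N \<le> n" for n x
  proof -
    define \<eta> where "\<eta> = \<epsilon> (Suc n)"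
    define \<alpha> where "\<alpha> = vfloor (R (Suc n) x)"
    define \<beta>\<^sub>0 where "\<beta>\<^sub>0 = vfloor (R n x)"
    have near: "\<bar>c n \<beta> - c n \<beta>\<^sub>0\<bar> \<le> 2 * (radius a + 2) * r ^ n" if "a \<eta> (\<alpha> - W \<eta> *v \<beta>) \<noteq> 0" for \<beta>
    proof -
      have "emb \<beta> - emb \<beta>\<^sub>0 = (emb \<beta> - contract \<eta> (emb \<alpha>)) +
          (- contract \<eta> (R (Suc n) x - emb \<alpha>) + (R n x - emb \<beta>\<^sub>0))"
        by (simp add: linear_diff[OF linear_contract] contract_R \<eta>_def)
      also have "infnorm \<dots> \<le> radius a + (1 + 1)"
      proof (intro order_trans[OF infnorm_triangle] add_mono)
        show "infnorm (emb \<beta> - contract \<eta> (emb \<alpha>)) \<le> radius a"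
          by (rule stencil_radius[of a, OF mask that])
        have "infnorm (contract \<eta> (R (Suc n) x - emb \<alpha>)) \<le> 3 / 4 * infnorm (R (Suc n) x - emb \<alpha>)"
          by (rule infnorm_contract)
        then show "infnorm (- contract \<eta> (R (Suc n) x - emb \<alpha>)) \<le> 1"
          using infnorm_vfloor[of "R (Suc n) x"] unfolding \<alpha>_def infnorm_neg by linarith
        show "infnorm (R n x - emb \<beta>\<^sub>0) \<le> 1"
          unfolding \<beta>\<^sub>0_def by (rule infnorm_vfloor)
      qed
      finally have "infnorm (emb \<beta> - emb \<beta>\<^sub>0) \<le> radius a + 2" by simp
      then have "2 * infnorm (emb \<beta> - emb \<beta>\<^sub>0) * r ^ n \<le> 2 * (radius a + 2) * r ^ n"
        using r by (intro mult_right_mono mult_left_mono) auto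
      then show ?thesis
        using step_bound_infnorm[OF c[OF \<open>N \<le> n\<close>], of \<beta> \<beta>\<^sub>0] by linarith
    qed
    have "0 \<le> 2 * (radius a + 2) * r ^ n" using radius_nonneg[of a] r by simp
    then have "\<bar>subdiv a \<eta> (c n) \<alpha> - c n \<beta>\<^sub>0 * subdiv a \<eta> (\<lambda>_. 1) \<alpha>\<bar> \<le>
        mask_norm a \<eta> * (2 * (radius a + 2) * r ^ n)"
      by (intro abs_subdiv_diff_le[of a, OF mask] near)
    also have "\<dots> \<le> A * (2 * (radius a + 2) * r ^ n)"
      using radius_nonneg[of a] r by (intro mult_right_mono A) simp
    finally have "\<bar>subdiv a \<eta> (c n) \<alpha> - c n \<beta>\<^sub>0\<bar> \<le> K * r ^ n" by (simp add: const K_def mult_ac)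
    moreover have "subdiv a \<eta> (c n) = c (Suc n)"
      by (simp add: c_def w_def P_Suc subdiv_word_append subdiv_word_simps \<eta>_def)
    ultimately show ?thesis by (simp add: F_def \<alpha>_def \<beta>\<^sub>0_def)
  qed
  then have "\<exists>l. \<forall>n\<ge>N. \<bar>l - F n x\<bar> \<le> K * r ^ n / (1 - r)" for x
    by (intro geometric_increments_limit r)
  then obtain f where f: "\<And>x n. N \<le> n \<Longrightarrow> \<bar>f x - F n x\<bar> \<le> K * r ^ n / (1 - r)" by metis
  define L where "L = K / (1 - r)"
  have f_F: "\<bar>f x - F n x\<bar> \<le> L * r ^ n" if "N \<le> n" for x n
    using f[OF that] by (simp add: L_def)
  have sample: "F n (contract_word (w n) (emb \<alpha>)) = c n \<alpha>" for n \<alpha>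
    by (simp add: F_def R_def map_W_word_contract_word)
  have conv: "converges_along a \<epsilon> f"
    unfolding converges_along_def
  proof (intro allI impI)
    fix e :: real assume "0 < e"
    then obtain M where M: "\<And>n. M \<le> n \<Longrightarrow> L * r ^ n \<le> e"
      using power_times_le[of r e L] r by auto
    have "\<bar>f (contract_word (w n) (emb \<alpha>)) - c n \<alpha>\<bar> \<le> e" if "max M N \<le> n" for n \<alpha>
      using f_F[of n "contract_word (w n) (emb \<alpha>)"] M[of n] that by (simp add: sample)
    then show "\<forall>\<^sub>F n in sequentially. \<forall>\<alpha>.
        \<bar>f (contract_word (P n \<epsilon>) (emb \<alpha>)) - subdiv_word a (P n \<epsilon>) delta \<alpha>\<bar> \<le> e"
      unfolding eventually_sequentially w_def c_def by blast
  qed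
  have "uniformly_continuous_on UNIV f"
    unfolding uniformly_continuous_on_def
  proof (intro allI impI)
    fix e :: real assume "0 < e"
    then obtain M where "\<And>n. M \<le> n \<Longrightarrow> (2 * L + 6) * r ^ n \<le> e / 2"
      using power_times_le[of r "e / 2" "2 * L + 6"] r by auto
    then obtain n where n: "(2 * L + 6) * r ^ n \<le> e / 2" "N \<le> n"
      by (meson max.cobounded1 max.cobounded2)
    have "linear (R n)" unfolding R_def by (rule matrix_vector_mul_linear)
    then obtain b where b: "0 < b" "\<And>x. norm (R n x) \<le> b * norm x"
      using linear_bounded_pos by blast
    have "dist (f x) (f y) < e" if xy: "dist x y < 1 / b" for x y
    proof -
      define \<alpha> \<beta> where "\<alpha> = vfloor (R n x)" and "\<beta> = vfloor (R n y)"
      have "norm (R n (x - y)) \<le> 1"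
        using b(2)[of "x - y"] xy b(1) by (simp add: dist_norm field_simps)
      then have 1: "infnorm (R n (x - y)) \<le> 1" using infnorm_le_norm order_trans by blast
      have "emb \<alpha> - emb \<beta> = - (R n x - emb \<alpha>) + (R n (x - y) + (R n y - emb \<beta>))"
        by (simp add: linear_diff[OF \<open>linear (R n)\<close>])
      also have "infnorm \<dots> \<le> 1 + (1 + 1)"
        using 1 unfolding \<alpha>_def \<beta>_def
        by (intro order_trans[OF infnorm_triangle] add_mono) (simp_all only: infnorm_neg infnorm_vfloor)
      finally have "2 * infnorm (emb \<alpha> - emb \<beta>) * r ^ n \<le> 6 * r ^ n"
        using r by (intro mult_right_mono) auto
      then have "\<bar>F n x - F n y\<bar> \<le> 6 * r ^ n"
        using step_bound_infnorm[OF c[OF n(2)], of \<alpha> \<beta>] unfolding F_def \<alpha>_def \<beta>_def by linarith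
      then have "\<bar>f x - f y\<bar> \<le> (2 * L + 6) * r ^ n"
        using f_F[OF n(2), of x] f_F[OF n(2), of y] by (simp add: algebra_simps)
      then show ?thesis using n(1) \<open>0 < e\<close> by (simp add: dist_real_def)
    qed
    then show "\<exists>d>0. \<forall>x\<in>UNIV. \<forall>x'\<in>UNIV. dist x' x < d \<longrightarrow> dist (f x') (f x) < e"
      using b(1) by (intro exI[of _ "1 / b"]) auto
  qed
  moreover have "\<exists>x. f x \<noteq> 0"
  proof (rule ccontr)
    assume "\<nexists>x. f x \<noteq> 0"
    then have f0: "f x = 0" for x by blast
    define k where "k = real (card (int_box (4 * radius a + 2)))"
    have "k \<ge> 0" by (simp add: k_def)
    then have "0 < 1 / (2 * (k + 1))" by simp
    from converges_alongD[OF conv this]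
    obtain n where "\<bar>f (contract_word (P n \<epsilon>) (emb \<alpha>)) - c n \<alpha>\<bar> \<le> 1 / (2 * (k + 1))" for \<alpha>
      unfolding c_def w_def by blast
    then have n: "\<bar>c n \<alpha>\<bar> \<le> 1 / (2 * (k + 1))" for \<alpha> by (simp add: f0)
    \<comment> \<open>The translates of \<open>c\<^sub>n\<close> by \<open>W\<^sub>w \<beta>\<close> add up to 1 at 0, and at most \<open>k\<close> of them contribute.\<close>
    have "1 = subdiv_word a (w n) (\<lambda>_. 1) 0"
      by (simp add: subdiv_word_const[of a, OF const])
    also have "\<dots> = (\<Sum>\<beta>\<in>window a (w n) 0. 1 * c n (0 - W_word (w n) *v \<beta>))"
      unfolding c_def
      by (rule subdiv_word_expand[of a, OF mask finite_window]) (auto intro: window_near)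
    also have "\<dots> \<le> (\<Sum>\<beta>\<in>window a (w n) 0. 1 / (2 * (k + 1)))"
      using n by (intro sum_mono) (simp add: abs_le_D1)
    also have "\<dots> = k / (2 * (k + 1))" by (simp add: card_window k_def)
    also have "\<dots> < 1" using \<open>k \<ge> 0\<close> by (simp add: field_simps)
    finally show False by simp
  qed
  ultimately show ?thesis using conv by blast
qed

theorem theorem4p14:
  fixes a :: "bit \<Rightarrow> int^2 \<Rightarrow> real" and B :: "bit \<Rightarrow> int^2 \<Rightarrow> real^2^2"
  assumes mask: "\<And>\<eta>. finite {\<alpha>. a \<eta> \<alpha> \<noteq> 0}"
    and repr: "\<And>\<eta>. symbol (a \<eta>) \<in> I \<Longrightarrow> representation_mask \<eta> (a \<eta>) (B \<eta>)"
  shows "scheme_convergent a \<longleftrightarrow>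
     (\<forall>\<eta>. (\<Sum>\<alpha> | a \<eta> \<alpha> \<noteq> 0. a \<eta> \<alpha>) = 8) \<and>
     (\<forall>\<eta>. symbol (a \<eta>) \<in> I) \<and> restricted_jsr B < 1"
proof
  assume conv: "scheme_convergent a"
  have const: "subdiv a \<eta> (\<lambda>_. 1) = (\<lambda>_. 1)" for \<eta>
  proof -
    obtain f x where "uniformly_continuous_on UNIV f" "f x \<noteq> 0" "converges_along a (\<lambda>_. \<eta>) f"
      using conv unfolding scheme_convergent_iff by blast
    then show ?thesis by (rule convergent_imp_reproduces_const[of a, OF mask])
  qed
  have small: "\<exists>n>0. step_bound (subdiv_word a (P n \<epsilon>) delta) q" if "0 < q" for \<epsilon> q
    using conv convergent_imp_small_steps[OF _ _ that] unfolding scheme_convergent_iff by blast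
  have sum: "(\<Sum>\<alpha> | a \<eta> \<alpha> \<noteq> 0. a \<eta> \<alpha>) = 8" and I: "symbol (a \<eta>) \<in> I" for \<eta>
    using reproduces_const_iff[of a \<eta>, OF mask] const by blast+
  obtain M \<theta> where "0 < M" "0 < \<theta>" "\<theta> < 1"
    "\<And>w c m. step_bound c m \<Longrightarrow> step_bound (subdiv_word a w c) (M * \<theta> ^ length w * m)"
    using uniform_decay[of a, OF mask const small] by blast
  then have "restricted_jsr B < 1"
    by (intro jsr_less_oneI[of a B \<theta> M, OF mask repr[OF I]])
  with sum I show "(\<forall>\<eta>. (\<Sum>\<alpha> | a \<eta> \<alpha> \<noteq> 0. a \<eta> \<alpha>) = 8) \<and> (\<forall>\<eta>. symbol (a \<eta>) \<in> I) \<and> restricted_jsr B < 1"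
    by blast
next
  assume *: "(\<forall>\<eta>. (\<Sum>\<alpha> | a \<eta> \<alpha> \<noteq> 0. a \<eta> \<alpha>) = 8) \<and> (\<forall>\<eta>. symbol (a \<eta>) \<in> I) \<and> restricted_jsr B < 1"
  then have const: "subdiv a \<eta> (\<lambda>_. 1) = (\<lambda>_. 1)" for \<eta>
    using reproduces_const_iff[of a \<eta>, OF mask] by blast
  obtain r N where "0 < r" "r < 1" "\<And>w. N \<le> length w \<Longrightarrow> step_bound (subdiv_word a w delta) (r ^ length w)"
    using jsr_less_oneD[of a B, OF mask const repr] * by blast
  then show "scheme_convergent a"
    unfolding scheme_convergent_iff using decay_imp_convergent[of a r N, OF mask const] by blast
qed

end
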